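(* Let $d\in\mathbb{N}$, $k\in\mathbb{N}_0$, $\delta,Q,R>0$, $\alpha>0$, let $\Omega\subset\mathbb{R}^d$ be open with $[0,1]^d\subset\Omega$, and let $f$ be $(Q,R)$-analytic on $\Omega$. Then there exists a constant $c_{d,k,\alpha,f}>0$ such that for every $\mathcal{N}\in\mathbb{N}$ there exists a tanh neural network $\widehat f^{\mathcal{N}}$ with two hidden layers of width at most $O(\mathcal{N})$ for $\mathcal{N}\to\infty$ such that $$\|f-\widehat f^{\mathcal{N}}\|_{W^{k,\infty}([0,1]^d)}\le c_{d,k,\alpha,f}\,\mathcal{N}^{\frac{k}{d+1}}\exp\left(-\alpha\,\mathcal{N}^{\frac{1}{d+1}}\log(\mathcal{N})\right)\le\frac{c_{d,k,\alpha,f}}{\mathcal{N}^{\alpha-k/(d+1)}}.$$ In particular, for $k=0$ it holds that $$\|f-\widehat f^{\mathcal{N}}\|_{L^\infty([0,1]^d)}\le(1+\delta)\,Q\,\exp\left(-\alpha\,\mathcal{N}^{\frac{1}{d+1}}\log(\mathcal{N})\right)\le\frac{(1+\delta)Q}{\mathcal{N}^{\alpha}}.$$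
   Context: $\mathbb{N}=\{1,2,\dots\}$, $\mathbb{N}_0=\mathbb{N}\cup\{0\}$. $|f|_{W^{m,\infty}(\Omega)}=\max_{|\beta|=m}\|D^\beta f\|_{L^\infty(\Omega)}$ and $\|f\|_{W^{k,\infty}(\Omega)}=\max_{0\le m\le k}|f|_{W^{m,\infty}(\Omega)}$. For $Q,R>0$, an analytic function $f$ is called $(Q,R)$-analytic if $|f|_{W^{s,\infty}([0,1]^d)}\le QR^{-s}s!$ for all $s\in\mathbb{N}_0$. A tanh neural network with $L-1$ hidden layers and layer widths $(l_0,\dots,l_L)$ is a function $\mathcal{A}_L\circ\sigma\circ\mathcal{A}_{L-1}\circ\sigma\circ\cdots\circ\sigma\circ\mathcal{A}_1:\mathbb{R}^{l_0}\to\mathbb{R}^{l_L}$, where the $\mathcal{A}_k:\mathbb{R}^{l_{k-1}}\to\mathbb{R}^{l_k}$ are affine maps and $\sigma=\tanh$ is applied componentwise. The hidden layers are layers $1,\dots,L-1$, layer $k$ having width $l_k$. The implied constant in the width bound $O(\mathcal{N})$ does not depend on $\mathcal{N}$ (it may depend on $d,k,\alpha,f$). *)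

theory Defs
  imports "HOL-Analysis.Analysis" "HOL-Probability.Essential_Supremum" "HOL-Library.Landau_Symbols"
begin

text \<open>
  Multi-indices are functions \<open>'d \<Rightarrow> nat\<close> on the finite type indexing the coordinates, and the
  coordinates are enumerated by \<open>from_nat_into UNIV\<close>, which is a bijection
  from \<open>{..<CARD('d)}\<close> onto \<open>UNIV\<close>.
\<close>

definition partial_deriv :: "'d::finite \<Rightarrow> (real^'d \<Rightarrow> real) \<Rightarrow> (real^'d \<Rightarrow> real)" where
  "partial_deriv i f = (\<lambda>x. deriv (\<lambda>t. f (x + t *\<^sub>R axis i 1)) 0)"

text \<open>
  Classical derivatives suffice, as the norms below are only applied to functions that are smooth on a
  neighbourhood of the cube; for these the order of differentiation, fixed here by the
  enumeration of the coordinates, is irrelevant.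
\<close>

definition mixed_deriv :: "('d::finite \<Rightarrow> nat) \<Rightarrow> (real^'d \<Rightarrow> real) \<Rightarrow> (real^'d \<Rightarrow> real)" where
  "mixed_deriv \<beta> f =
     fold (\<lambda>j. partial_deriv (from_nat_into UNIV j) ^^ \<beta> (from_nat_into UNIV j)) [0..<CARD('d)] f"

definition Linf_norm :: "(real^'d::finite) set \<Rightarrow> (real^'d \<Rightarrow> real) \<Rightarrow> ereal" where
  "Linf_norm S g = esssup (lebesgue_on S) (\<lambda>x. ereal \<bar>g x\<bar>)"

definition sobolev_seminorm :: "nat \<Rightarrow> (real^'d::finite) set \<Rightarrow> (real^'d \<Rightarrow> real) \<Rightarrow> ereal" where
  "sobolev_seminorm m S f = (MAX \<beta>\<in>{\<beta>. (\<Sum>i\<in>UNIV. \<beta> i) = m}. Linf_norm S (mixed_deriv \<beta> f))"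

definition sobolev_norm :: "nat \<Rightarrow> (real^'d::finite) set \<Rightarrow> (real^'d \<Rightarrow> real) \<Rightarrow> ereal" where
  "sobolev_norm k S f = (MAX m\<in>{0..k}. sobolev_seminorm m S f)"

text \<open>The maximum in the seminorm is over a finite nonempty set.\<close>

lemma finite_multi_indices: "finite {\<beta>::'d::finite \<Rightarrow> nat. (\<Sum>i\<in>UNIV. \<beta> i) = m}"
proof (rule finite_subset)
  show "{\<beta>::'d \<Rightarrow> nat. (\<Sum>i\<in>UNIV. \<beta> i) = m} \<subseteq> PiE UNIV (\<lambda>_. {..m})"
    by (auto simp: PiE_def intro: member_le_sum)
qed (simp add: finite_PiE)

lemma multi_indices_nonempty: "{\<beta>::'d::finite \<Rightarrow> nat. (\<Sum>i\<in>UNIV. \<beta> i) = m} \<noteq> {}"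
proof -
  have "(\<Sum>i\<in>UNIV. (if i = (undefined::'d) then m else 0)) = m"
    by simp
  then show ?thesis
    by blast
qed

definition real_analytic_on :: "(real^'d::finite \<Rightarrow> real) \<Rightarrow> (real^'d) set \<Rightarrow> bool" where
  "real_analytic_on f S \<longleftrightarrow>
     (\<forall>x\<in>S. \<exists>a. \<exists>r>0. \<forall>y\<in>ball x r.
        ((\<lambda>\<beta>::'d \<Rightarrow> nat. a \<beta> * (\<Prod>i\<in>UNIV. (y $ i - x $ i) ^ \<beta> i)) has_sum f y) UNIV)"

abbreviation unit_cube :: "(real^'d::finite) set" where
  "unit_cube \<equiv> cbox 0 1"

definition QR_analytic ::
    "real \<Rightarrow> real \<Rightarrow> (real^'d::finite) set \<Rightarrow> (real^'d \<Rightarrow> real) \<Rightarrow> bool" where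
  "QR_analytic Q R \<Omega> f \<longleftrightarrow>
     real_analytic_on f \<Omega> \<and>
     (\<forall>s. sobolev_seminorm s unit_cube f \<le> ereal (Q * (1 / R) ^ s * fact s))"

text \<open>
  Layer widths vary inside the theorem, so the layers are not typed by their dimension: a vector
  of \<open>\<real>\<^sup>n\<close> is represented by a function \<open>nat \<Rightarrow> real\<close> whose entries with index at least \<open>n\<close> are
  ignored as input and are zero as output of an affine map.
\<close>

definition affine_map :: "nat \<Rightarrow> nat \<Rightarrow> ((nat \<Rightarrow> real) \<Rightarrow> (nat \<Rightarrow> real)) \<Rightarrow> bool" where
  "affine_map m n A \<longleftrightarrow>
     (\<exists>W b. \<forall>x. A x = (\<lambda>i. if i < n then (\<Sum>j<m. W i j * x j) + b i else 0))"

text \<open>\<open>tanh_compose A h\<close> has \<open>h\<close> hidden layers and uses the maps \<open>A 1, \<dots>, A (h + 1)\<close>.\<close>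

primrec tanh_compose ::
    "(nat \<Rightarrow> (nat \<Rightarrow> real) \<Rightarrow> (nat \<Rightarrow> real)) \<Rightarrow> nat \<Rightarrow> (nat \<Rightarrow> real) \<Rightarrow> (nat \<Rightarrow> real)" where
  "tanh_compose A 0 = A 1"
| "tanh_compose A (Suc h) = A (h + 2) \<circ> (\<lambda>y i. tanh (y i)) \<circ> tanh_compose A h"

text \<open>The list \<open>l\<close> contains the widths of all layers, input and output included.\<close>

definition tanh_network :: "nat list \<Rightarrow> ((nat \<Rightarrow> real) \<Rightarrow> (nat \<Rightarrow> real)) \<Rightarrow> bool" where
  "tanh_network l F \<longleftrightarrow>
     length l \<ge> 2 \<and> (\<forall>n\<in>set l. n > 0) \<and>
     (\<exists>A. (\<forall>k\<in>{1..<length l}. affine_map (l ! (k - 1)) (l ! k) (A k)) \<and>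
          F = tanh_compose A (length l - 2))"

definition coords :: "real^'d::finite \<Rightarrow> nat \<Rightarrow> real" where
  "coords x = (\<lambda>j. if j < CARD('d) then x $ from_nat_into UNIV j else 0)"

text \<open>The real-valued function on \<open>\<real>\<^sup>d\<close> given by a network with output width one.\<close>

definition realize :: "((nat \<Rightarrow> real) \<Rightarrow> (nat \<Rightarrow> real)) \<Rightarrow> real^'d::finite \<Rightarrow> real" where
  "realize F x = F (coords x) 0"

end

(*
  A real-analytic function on a neighbourhood of the cube is approximated there at a geometric rate
  by polynomials G_s of degree O(s): truncated power series do this locally, and two local
  approximations are glued with a polynomial step function (the probability that a majority of
  O(s) coin flips shows heads) which is exponentially close to 0 or 1 away from the overlap and so
  beats the exponential growth of the polynomials.  Markov's inequality applied to the differences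
  of consecutive G_s carries the rate over to all derivatives.

  With a fixed number of neurons a polynomial of degree n is a C^k-limit of networks: the first
  layer yields tanh(h x_i)/h -> x_i, the second one exp(t q.x) for multi-indices q with entries at
  most n, as a shifted and scaled tanh tends to exp; and (exp(t x_i) - 1)/t -> x_i turns
  combinations of these exponentials into polynomials.  So (O(s))^d neurons give an error of order
  r^s with r < 1, and s = N^(1/d) beats exp(-alpha N^(1/(d+1)) log N) for every alpha.
*)
theory Submission
  imports Defs "HOL-Complex_Analysis.Cauchy_Integral_Formula" "HOL-Real_Asymp.Real_Asymp"
begin

text \<open>A power series of \<open>f\<close> need not converge on the whole cube, so no single
  Taylor polynomial serves. Off its own piece a local polynomial is only known to grow like
  \<open>K ^ s\<close>, hence that growth has to be carried through the gluing. Passing from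
  polynomials to networks costs no width: weights may be arbitrarily large, so the limit is
  approached with the number of neurons fixed, and this number is the count of exponentials alone.
  The constant \<open>c\<close> is chosen before \<open>\<delta>\<close>, \<open>Q\<close> and
  \<open>R\<close>, yet for \<open>k = 0\<close> the error must stay below
  \<open>(1 + \<delta>) * Q\<close> times the exponential. Every admissible \<open>Q\<close> is at
  least the sup norm of \<open>f\<close> on the cube, so any positive \<open>c\<close> below that
  norm will do, and a function of norm 0 is matched by the zero network. Such a small
  \<open>c\<close> has to work for small \<open>N\<close> too; since the width bound is asymptotic,
  finitely many \<open>N\<close> may take as many neurons as they need.\<close>

section \<open>Markov's inequality at an endpoint of an interval\<close>

lemma poly_eq_sum_of_degree_le:
  assumes "degree (p :: 'a::comm_semiring_1 poly) \<le> n"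
  shows "poly p x = (\<Sum>i\<le>n. coeff p i * x ^ i)"
  unfolding poly_altdef using assms
  by (intro sum.mono_neutral_left) (auto intro: le_degree)

text \<open>Cauchy's estimate on the unit circle: the \<open>k\<close>-th derivative at 0 is
  \<open>fact k\<close> times the coefficient.\<close>

lemma norm_coeff_le_of_bounded_on_circle:
  fixes G :: "complex poly"
  assumes "\<And>z. norm z = 1 \<Longrightarrow> norm (poly G z) \<le> M"
  shows "norm (coeff G k) \<le> M"
proof -
  have d: "(deriv ^^ k) (poly H) = poly ((pderiv ^^ k) H)" for H :: "complex poly"
  proof (induction k arbitrary: H)
    case (Suc k)
    have "deriv (poly H) = poly (pderiv H)"
      by (rule ext) (simp add: DERIV_imp_deriv poly_DERIV)
    then show ?case
      by (simp only: funpow_Suc_right o_apply Suc.IH)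
  qed simp
  have "norm ((deriv ^^ k) (poly G) 0) \<le> fact k * M / 1 ^ k"
    by (rule Cauchy_inequality) (auto intro!: holomorphic_intros continuous_intros assms)
  moreover have "(deriv ^^ k) (poly G) 0 = fact k * coeff G k"
    by (simp add: d poly_0_coeff_0 coeff_higher_pderiv pochhammer_fact)
  ultimately have "fact k * norm (coeff G k) \<le> fact k * M"
    by (simp add: norm_mult)
  then show ?thesis
    by simp
qed

text \<open>The substitution \<open>x = sin\<^sup>2(\<phi> / 2) = - (v - 1)\<^sup>2 / (4 v)\<close>, \<open>v = exp (i \<phi>)\<close>, turns \<open>p\<close> into \<open>v\<^sup>n p(x)\<close>, a
  polynomial in \<open>v\<close> bounded on the unit circle, whose second derivative at 1 sees \<open>p'(0)\<close>.\<close>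

lemma Markov_endpoint_unit:
  fixes p :: "real poly"
  assumes deg: "degree p \<le> n" and M: "\<And>x. 0 \<le> x \<Longrightarrow> x \<le> 1 \<Longrightarrow> \<bar>poly p x\<bar> \<le> M"
  shows "\<bar>coeff p 1\<bar> \<le> 18 * (real n + 1) ^ 3 * M"
proof (cases "n = 0")
  case True
  then have "coeff p 1 = 0"
    using deg by (intro coeff_eq_0) auto
  moreover have "0 \<le> M"
    using M[of 0] by auto
  ultimately show ?thesis
    using True by simp
next
  case False
  have M0: "0 \<le> M"
    using M[of 0] by auto
  \<comment> \<open>\<open>q\<close> is \<open>- (v - 1)^2 / 4\<close>, so \<open>H j\<close> is
    \<open>v ^ n\<close> times the \<open>j\<close>-th power of \<open>q(v) / v\<close>. The double
    zero of \<open>q\<close> at 1 removes all terms with \<open>j \<ge> 2\<close> from the second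
    derivative there.\<close>
  define q :: "complex poly" where "q = [:-1/4, 1/2, -1/4:]"
  define H where "H j = monom 1 (n - j) * q ^ j" for j
  define G where "G = (\<Sum>j\<le>n. smult (complex_of_real (coeff p j)) (H j))"
  have q1: "poly q 1 = 0" "poly (pderiv q) 1 = 0" "poly (pderiv (pderiv q)) 1 = -1/2"
    by (simp_all add: q_def pderiv_pCons)
  have degq: "degree q = 2"
    by (simp add: q_def)
  have degG: "degree G \<le> 2 * n"
    unfolding G_def
  proof (rule degree_sum_le)
    fix j assume j: "j \<in> {..n}"
    have "degree (H j) \<le> degree (monom (1::complex) (n - j)) + degree (q ^ j)"
      unfolding H_def by (rule degree_mult_le)
    also have "\<dots> \<le> (n - j) + 2 * j"
      using degree_power_le[of q j] by (simp add: degq degree_monom_eq)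
    also have "\<dots> \<le> 2 * n"
      using j by auto
    finally show "degree (smult (complex_of_real (coeff p j)) (H j)) \<le> 2 * n"
      using degree_smult_le order_trans by blast
  qed simp
  have circle: "norm (poly G v) \<le> M" if v: "norm v = 1" for v
  proof -
    have v0: "v \<noteq> 0"
      using v by auto
    define x where "x = (1 - Re v) / 2"
    have x01: "0 \<le> x" "x \<le> 1"
      using abs_Re_le_cmod[of v] v by (auto simp: x_def)
    \<comment> \<open>On the unit circle \<open>cnj v\<close> is the inverse of \<open>v\<close>,
      which turns \<open>2 * v * Re v\<close> into \<open>v * v + 1\<close>.\<close>
    have "v * cnj v = 1"
      using v by (simp add: complex_norm_square[symmetric])
    moreover have "complex_of_real (Re v) = (v + cnj v) / 2"
      by (simp add: complex_add_cnj)
    ultimately have "v * complex_of_real (Re v) * 2 = v * v + 1"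
      by (simp add: algebra_simps)
    then have "8 * (v * complex_of_real (Re v) * 2) = 8 * (v * v + 1)"
      by simp
    then have qx: "poly q v = v * complex_of_real x"
      by (simp add: q_def x_def field_simps)
    have "poly G v = (\<Sum>j\<le>n. complex_of_real (coeff p j) * (v ^ (n - j) * (v * complex_of_real x) ^ j))"
      by (simp add: G_def H_def poly_sum poly_monom qx)
    also have "\<dots> = (\<Sum>j\<le>n. v ^ n * complex_of_real (coeff p j * x ^ j))"
      by (intro sum.cong refl) (auto simp: power_mult_distrib mult_ac power_add[symmetric])
    also have "\<dots> = v ^ n * complex_of_real (poly p x)"
      by (simp add: poly_eq_sum_of_degree_le[OF deg] sum_distrib_left)
    finally show ?thesis
      using M[OF x01] v by (simp add: norm_mult norm_power)
  qed
  have coeffG: "norm (coeff G k) \<le> M" for k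
    using norm_coeff_le_of_bounded_on_circle circle by blast
  have d2: "poly (pderiv (pderiv (H j))) 1 = (if j = 0 then of_nat (n * (n - 1)) else if j = 1 then -1/2 else 0)" for j
  proof (cases j)
    case 0
    then show ?thesis
      by (simp add: H_def pderiv_monom poly_monom)
  next
    case (Suc i)
    then have "H j = (monom 1 (n - j) * q ^ i) * q"
      by (simp add: H_def mult_ac)
    then have "poly (pderiv (pderiv (H j))) 1 = poly (monom 1 (n - j) * q ^ i) 1 * (-1/2)"
      by (simp add: pderiv_mult pderiv_add q1)
    then show ?thesis
      using Suc by (simp add: poly_monom q1 power_0_left)
  qed
  have pds: "pderiv (pderiv (\<Sum>j\<in>S. smult (c j) (F j))) = (\<Sum>j\<in>S. smult (c j) (pderiv (pderiv (F j))))"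
    for S :: "nat set" and c :: "nat \<Rightarrow> complex" and F
    by (induction S rule: infinite_finite_induct) (simp_all add: pderiv_add pderiv_smult)
  have "poly (pderiv (pderiv G)) 1 = (\<Sum>j\<le>n. complex_of_real (coeff p j) * poly (pderiv (pderiv (H j))) 1)"
    by (simp add: G_def pds poly_sum)
  also have "\<dots> = (\<Sum>j\<in>{0,1}. complex_of_real (coeff p j) * poly (pderiv (pderiv (H j))) 1)"
    using False by (intro sum.mono_neutral_right) (auto simp: d2)
  also have "\<dots> = complex_of_real (coeff p 0 * (n * (n - 1)) - coeff p 1 / 2)"
    by (simp add: d2)
  finally have eq: "poly (pderiv (pderiv G)) 1 = complex_of_real (coeff p 0 * (n * (n - 1)) - coeff p 1 / 2)" .
  have "degree (pderiv (pderiv G)) \<le> 2 * n"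
    using degG by (simp add: degree_pderiv)
  then have "poly (pderiv (pderiv G)) 1 = (\<Sum>k\<le>2*n. coeff (pderiv (pderiv G)) k)"
    by (simp add: poly_eq_sum_of_degree_le)
  \<comment> \<open>The \<open>2 * n + 1\<close> coefficients are estimated one by one. This yields
    a cubic factor instead of Markov's quadratic one, which is harmless next to a geometric
    rate.\<close>
  also have "norm \<dots> \<le> (\<Sum>k\<le>2*n. (2 * real n + 1) * (2 * real n + 2) * M)"
  proof (intro sum_norm_le)
    fix k assume k: "k \<in> {..2*n}"
    have "norm (coeff (pderiv (pderiv G)) k) = ((real k + 1) * (real k + 2)) * norm (coeff G (k + 2))"
      by (simp add: coeff_pderiv norm_mult algebra_simps del: of_nat_Suc) (simp add: algebra_simps)
    also have "\<dots> \<le> ((2 * real n + 1) * (2 * real n + 2)) * M"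
      using k coeffG M0 by (intro mult_mono) auto
    finally show "norm (coeff (pderiv (pderiv G)) k) \<le> (2 * real n + 1) * (2 * real n + 2) * M" .
  qed
  finally have "\<bar>coeff p 0 * (n * (n - 1)) - coeff p 1 / 2\<bar> \<le> (2 * real n + 1) * ((2 * real n + 1) * (2 * real n + 2) * M)"
    unfolding eq norm_of_real by (simp add: add.commute)
  \<comment> \<open>The term with \<open>j = 0\<close> enters with \<open>coeff p 0\<close>, the
    value of \<open>p\<close> at 0, which is bounded by \<open>M\<close>.\<close>
  moreover have "\<bar>coeff p 0 * (n * (n - 1))\<bar> \<le> M * (real n * real n)"
    using M[of 0] False by (auto simp: poly_0_coeff_0 abs_mult intro!: mult_mono)
  moreover have "\<bar>c\<bar> \<le> 2 * (P + R)" if "\<bar>X - c / 2\<bar> \<le> P" "\<bar>X\<bar> \<le> R" for X c P R :: real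
    using that by (auto simp: abs_le_iff)
  ultimately have "\<bar>coeff p 1\<bar> \<le> 2 * ((2 * real n + 1) * ((2 * real n + 1) * (2 * real n + 2) * M) + M * (real n * real n))"
    by blast
  also have "\<dots> = (2 * ((2 * real n + 1) * (2 * real n + 1) * (2 * real n + 2) + real n * real n)) * M"
    by (simp add: algebra_simps)
  also have "\<dots> \<le> 18 * (real n + 1) ^ 3 * M"
    using M0 by (intro mult_right_mono) (auto simp: power3_eq_cube algebra_simps)
  finally show ?thesis .
qed

text \<open>With negative \<open>L\<close> the point \<open>c\<close> is the right endpoint of the
  interval, so both one-sided versions are covered.\<close>

lemma Markov_endpoint:
  fixes p :: "real poly"
  assumes deg: "degree p \<le> n" and L: "L \<noteq> 0"
    and M: "\<And>t. 0 \<le> t \<Longrightarrow> t \<le> 1 \<Longrightarrow> \<bar>poly p (c + L * t)\<bar> \<le> M"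
  shows "\<bar>poly (pderiv p) c\<bar> \<le> 18 * (real n + 1) ^ 3 * M / \<bar>L\<bar>"
proof -
  define q where "q = pcompose p [:c, L:]"
  have "degree q \<le> n"
    unfolding q_def using degree_pcompose_le[of p "[:c, L:]"] deg L by simp
  moreover have "\<bar>poly q t\<bar> \<le> M" if "0 \<le> t" "t \<le> 1" for t
    using M[OF that] by (simp add: q_def poly_pcompose mult.commute)
  ultimately have "\<bar>coeff q 1\<bar> \<le> 18 * (real n + 1) ^ 3 * M"
    by (rule Markov_endpoint_unit)
  moreover have "coeff q 1 = poly (pderiv q) 0"
    by (simp add: poly_0_coeff_0 coeff_pderiv)
  moreover have "\<dots> = poly (pderiv p) c * L"
    by (simp add: q_def pderiv_pcompose poly_pcompose pderiv_pCons)
  ultimately show ?thesis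
    using L by (simp add: abs_mult field_simps)
qed

section \<open>Partial derivatives and bounds on all derivatives up to order k\<close>

text \<open>A relation between function and derivative lets the calculus rules run without separate
  differentiability conditions; \<open>partial_deriv\<close>, being built on \<open>deriv\<close>,
  is meaningful only where the derivative exists.\<close>

definition has_partial :: "(real^'d) set \<Rightarrow> 'd::finite \<Rightarrow> (real^'d \<Rightarrow> real) \<Rightarrow> (real^'d \<Rightarrow> real) \<Rightarrow> bool" where
  "has_partial U i g g' \<longleftrightarrow>
     (\<forall>x\<in>U. ((\<lambda>t. g (x + t *\<^sub>R axis i 1)) has_real_derivative g' x) (at 0))"

lemma has_partial_const: "has_partial U i (\<lambda>_. c) (\<lambda>_. 0)"
  by (simp add: has_partial_def)

lemma has_partial_coord: "has_partial U i (\<lambda>x. x $ j) (\<lambda>_. if i = j then 1 else 0)"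
  unfolding has_partial_def by (auto simp: axis_def intro!: derivative_eq_intros)

lemma has_partial_add:
  "has_partial U i g g' \<Longrightarrow> has_partial U i h h' \<Longrightarrow> has_partial U i (\<lambda>x. g x + h x) (\<lambda>x. g' x + h' x)"
  unfolding has_partial_def by (auto intro!: derivative_eq_intros)

lemma has_partial_diff:
  "has_partial U i g g' \<Longrightarrow> has_partial U i h h' \<Longrightarrow> has_partial U i (\<lambda>x. g x - h x) (\<lambda>x. g' x - h' x)"
  unfolding has_partial_def by (auto intro!: derivative_eq_intros)

lemma has_partial_mult:
  "has_partial U i g g' \<Longrightarrow> has_partial U i h h' \<Longrightarrow>
    has_partial U i (\<lambda>x. g x * h x) (\<lambda>x. g' x * h x + g x * h' x)"
  unfolding has_partial_def by (auto intro!: derivative_eq_intros)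

lemma has_partial_comp:
  assumes "has_partial U i g g'" and "\<And>v. (\<sigma> has_real_derivative \<sigma>' v) (at v)"
  shows "has_partial U i (\<lambda>x. \<sigma> (g x)) (\<lambda>x. \<sigma>' (g x) * g' x)"
  unfolding has_partial_def
proof
  fix x assume "x \<in> U"
  then have "((\<lambda>t. g (x + t *\<^sub>R axis i 1)) has_real_derivative g' x) (at 0)"
    using assms(1) by (simp add: has_partial_def)
  from DERIV_chain2[OF _ this, of \<sigma> "\<sigma>' (g x)"] assms(2)[of "g x"]
  show "((\<lambda>t. \<sigma> (g (x + t *\<^sub>R axis i 1))) has_real_derivative \<sigma>' (g x) * g' x) (at 0)"
    by simp
qed

lemma line_in_open:
  assumes "open U" "x \<in> U"
  obtains e where "e > 0" "\<And>t. \<bar>t\<bar> < e \<Longrightarrow> x + t *\<^sub>R axis i 1 \<in> (U :: (real^'d::finite) set)"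
proof -
  obtain e where e: "e > 0" "ball x e \<subseteq> U"
    using assms open_contains_ball by blast
  have "x + t *\<^sub>R axis i 1 \<in> U" if "\<bar>t\<bar> < e" for t
    using that e(2) by (auto simp: dist_norm intro!: subsetD[OF e(2)])
  with e(1) show thesis
    using that by blast
qed

lemma has_partial_cong:
  assumes "open U" "has_partial U i g g'" "\<And>x. x \<in> U \<Longrightarrow> g x = h x"
  shows "has_partial U i h g'"
  unfolding has_partial_def
proof
  fix x assume x: "x \<in> U"
  obtain e where e: "e > 0" "\<And>t. \<bar>t\<bar> < e \<Longrightarrow> x + t *\<^sub>R axis i 1 \<in> U"
    using line_in_open[OF assms(1) x] by blast
  have "((\<lambda>t. g (x + t *\<^sub>R axis i 1)) has_real_derivative g' x) (at 0)"
    using assms(2) x by (simp add: has_partial_def)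
  then show "((\<lambda>t. h (x + t *\<^sub>R axis i 1)) has_real_derivative g' x) (at 0)"
    by (rule has_field_derivative_transform_within_open[where S = "{-e<..<e}"])
       (use e assms(3) in auto)
qed

lemma partial_deriv_eq:
  assumes "has_partial U i g g'" "x \<in> U"
  shows "partial_deriv i g x = g' x"
  using assms by (auto simp: partial_deriv_def has_partial_def intro!: DERIV_imp_deriv)

definition C0_le :: "(real^'d::finite) set \<Rightarrow> real \<Rightarrow> (real^'d \<Rightarrow> real) \<Rightarrow> bool" where
  "C0_le U e g \<longleftrightarrow> continuous_on U g \<and> (\<forall>x\<in>U. \<bar>g x\<bar> \<le> e)"

text \<open>Partial derivatives are iterated in every order of the coordinates, so the order fixed
  in \<open>mixed_deriv\<close> is among them. Continuity is part of each bound because the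
  essential supremum asks for measurability.\<close>

primrec Ck_le :: "(real^'d::finite) set \<Rightarrow> nat \<Rightarrow> real \<Rightarrow> (real^'d \<Rightarrow> real) \<Rightarrow> bool" where
  "Ck_le U 0 e g \<longleftrightarrow> C0_le U e g"
| "Ck_le U (Suc k) e g \<longleftrightarrow> C0_le U e g \<and> (\<forall>i. \<exists>g'. has_partial U i g g' \<and> Ck_le U k e g')"

lemma C0_le_add: "C0_le U a g \<Longrightarrow> C0_le U b h \<Longrightarrow> C0_le U (a + b) (\<lambda>x. g x + h x)"
  unfolding C0_le_def by (auto intro!: continuous_intros order.trans[OF abs_triangle_ineq] add_mono)

lemma Ck_le_0: "Ck_le U k e g \<Longrightarrow> C0_le U e g"
  by (cases k) auto

lemma Ck_le_mono: "Ck_le U k e g \<Longrightarrow> e \<le> e' \<Longrightarrow> Ck_le U k e' g"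
  by (induction k arbitrary: g) (force simp: C0_le_def, simp add: C0_le_def, meson order_trans)

lemma Ck_le_add:
  "Ck_le U k a g \<Longrightarrow> Ck_le U k b h \<Longrightarrow> Ck_le U k (a + b) (\<lambda>x. g x + h x)"
proof (induction k arbitrary: g h)
  case (Suc k)
  have "\<exists>f. has_partial U i (\<lambda>x. g x + h x) f \<and> Ck_le U k (a + b) f" for i
  proof -
    obtain g' where "has_partial U i g g'" "Ck_le U k a g'"
      using Suc.prems(1) by auto
    moreover obtain h' where "has_partial U i h h'" "Ck_le U k b h'"
      using Suc.prems(2) by auto
    ultimately show ?thesis
      using has_partial_add Suc.IH by (intro exI[of _ "\<lambda>x. g' x + h' x"]) auto
  qed
  then show ?case
    using Suc.prems by (auto intro: C0_le_add)
qed (simp add: C0_le_add)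

lemma Ck_le_cong:
  assumes "open U" "Ck_le U k e g" "\<And>x. x \<in> U \<Longrightarrow> g x = h x"
  shows "Ck_le U k e h"
proof -
  have "C0_le U e h"
    using Ck_le_0[OF assms(2)] assms(3) continuous_on_cong[of U U g h] by (auto simp: C0_le_def)
  then show ?thesis
    using assms(2) has_partial_cong[OF assms(1), of _ g _ h] assms(3) by (cases k) (auto, metis)
qed

text \<open>The witness in \<open>Ck_le\<close> and \<open>partial_deriv i g\<close> agree on
  \<open>U\<close>; as \<open>U\<close> is open, this carries over to the higher
  derivatives.\<close>

lemma Ck_le_partial_deriv:
  assumes "open U" "Ck_le U (Suc k) e g"
  shows "Ck_le U k e (partial_deriv i g)"
proof -
  obtain g' where g': "has_partial U i g g'" "Ck_le U k e g'"
    using assms(2) by auto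
  show ?thesis
    by (rule Ck_le_cong[OF assms(1) g'(2)]) (simp add: partial_deriv_eq[OF g'(1)])
qed

lemma Ck_le_partial_deriv_funpow:
  assumes "open U" "Ck_le U (m + k) e g"
  shows "Ck_le U k e ((partial_deriv i ^^ m) g)"
  using assms(2)
proof (induction m arbitrary: g)
  case (Suc m)
  then show ?case
    by (simp only: funpow_Suc_right o_apply add_Suc Ck_le_partial_deriv[OF assms(1)])
qed simp

lemma Ck_le_fold_partial_deriv:
  assumes "open U" "Ck_le U (sum_list (map b js) + k) e g"
  shows "Ck_le U k e (fold (\<lambda>j. partial_deriv (\<pi> j) ^^ b j) js g)"
  using assms(2)
proof (induction js arbitrary: g)
  case (Cons j js)
  then have "Ck_le U (sum_list (map b js) + k) e ((partial_deriv (\<pi> j) ^^ b j) g)"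
    by (intro Ck_le_partial_deriv_funpow[OF assms(1)]) (simp add: add.assoc)
  then show ?case
    using Cons.IH by simp
qed simp

lemma Ck_le_mixed_deriv:
  fixes \<beta> :: "'d::finite \<Rightarrow> nat"
  assumes "open U" "Ck_le U k e g" "(\<Sum>i\<in>UNIV. \<beta> i) \<le> k"
  shows "C0_le U e (mixed_deriv \<beta> g)"
proof -
  let ?\<pi> = "from_nat_into (UNIV :: 'd set)"
  have "bij_betw ?\<pi> {..<CARD('d)} UNIV"
    using bij_betw_from_nat_into_finite[of "UNIV :: 'd set"] by simp
  then have "(\<Sum>i\<in>UNIV. \<beta> i) = (\<Sum>j<CARD('d). \<beta> (?\<pi> j))"
    by (simp add: sum.reindex_bij_betw)
  also have "\<dots> = sum_list (map (\<lambda>j. \<beta> (?\<pi> j)) [0..<CARD('d)])"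
    by (simp add: interv_sum_list_conv_sum_set_nat atLeast0LessThan)
  \<comment> \<open>\<open>m\<close> is the number of derivatives left over: each application of
    \<open>partial_deriv\<close> uses up one of the \<open>k\<close>.\<close>
  finally obtain m where "k = sum_list (map (\<lambda>j. \<beta> (?\<pi> j)) [0..<CARD('d)]) + m"
    using assms(3) by (auto simp: le_iff_add)
  then have "Ck_le U m e (mixed_deriv \<beta> g)"
    unfolding mixed_deriv_def using assms(1,2) Ck_le_fold_partial_deriv by blast
  then show ?thesis
    by (rule Ck_le_0)
qed

lemma Linf_norm_le:
  assumes "C0_le U e g" "unit_cube \<subseteq> U"
  shows "Linf_norm unit_cube g \<le> ereal e"
  unfolding Linf_norm_def
proof (rule esssup_I)
  have "continuous_on unit_cube g"
    using assms continuous_on_subset by (auto simp: C0_le_def)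
  then have "g \<in> borel_measurable (lebesgue_on unit_cube)"
    by (intro continuous_imp_measurable_on_sets_lebesgue) auto
  then show "(\<lambda>x. ereal \<bar>g x\<bar>) \<in> borel_measurable (lebesgue_on unit_cube)"
    by measurable
  show "AE x in lebesgue_on unit_cube. ereal \<bar>g x\<bar> \<le> ereal e"
    using assms by (intro AE_I2) (auto simp: C0_le_def space_restrict_space)
qed

lemma sobolev_norm_le:
  assumes "open U" "Ck_le U k e g" "unit_cube \<subseteq> U"
  shows "sobolev_norm k unit_cube g \<le> ereal e"
proof -
  have "sobolev_seminorm m unit_cube g \<le> ereal e" if "m \<le> k" for m
    unfolding sobolev_seminorm_def
    using finite_multi_indices multi_indices_nonempty that assms
    by (subst Max_le_iff) (auto intro!: Linf_norm_le Ck_le_mixed_deriv)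
  then show ?thesis
    unfolding sobolev_norm_def by (subst Max_le_iff) auto
qed

section \<open>Uniform convergence of all derivatives up to order k\<close>

text \<open>A bounded limit makes uniform convergence stable under products; continuity is what
  \<open>C0_le\<close> demands of the difference.\<close>

definition C0_conv :: "(real^'d::finite) set \<Rightarrow> (nat \<Rightarrow> real^'d \<Rightarrow> real) \<Rightarrow> (real^'d \<Rightarrow> real) \<Rightarrow> bool" where
  "C0_conv U gs g \<longleftrightarrow>
     uniform_limit U gs g sequentially \<and> bounded (g ` U) \<and> continuous_on U g \<and> (\<forall>n. continuous_on U (gs n))"

primrec Ck_conv :: "(real^'d::finite) set \<Rightarrow> nat \<Rightarrow> (nat \<Rightarrow> real^'d \<Rightarrow> real) \<Rightarrow> (real^'d \<Rightarrow> real) \<Rightarrow> bool" where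
  "Ck_conv U 0 gs g \<longleftrightarrow> C0_conv U gs g"
| "Ck_conv U (Suc k) gs g \<longleftrightarrow> C0_conv U gs g \<and>
     (\<forall>i. \<exists>gs' g'. (\<forall>n. has_partial U i (gs n) (gs' n)) \<and> has_partial U i g g' \<and> Ck_conv U k gs' g')"

lemma Ck_conv_0: "Ck_conv U k gs g \<Longrightarrow> C0_conv U gs g"
  by (cases k) auto

lemma Ck_conv_SucE:
  assumes "Ck_conv U (Suc k) gs g"
  obtains gs' g' where "\<And>n. has_partial U i (gs n) (gs' n)" "has_partial U i g g'" "Ck_conv U k gs' g'"
  using assms by auto metis

lemma Ck_conv_SucI:
  assumes "C0_conv U gs g"
    and "\<And>i. \<exists>gs' g'. (\<forall>n. has_partial U i (gs n) (gs' n)) \<and> has_partial U i g g' \<and> Ck_conv U k gs' g'"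
  shows "Ck_conv U (Suc k) gs g"
  using assms by simp

text \<open>The product and chain rules contain undifferentiated functions next to derivatives, so
  inductions on \<open>k\<close> need these functions at the lower order as well.\<close>

lemma Ck_conv_SucD: "Ck_conv U (Suc k) gs g \<Longrightarrow> Ck_conv U k gs g"
proof (induction k arbitrary: gs g)
  case (Suc k)
  show ?case
  proof (rule Ck_conv_SucI)
    show "C0_conv U gs g"
      using Suc.prems by (rule Ck_conv_0)
    show "\<exists>gs' g'. (\<forall>n. has_partial U i (gs n) (gs' n)) \<and> has_partial U i g g' \<and> Ck_conv U k gs' g'" for i
      using Ck_conv_SucE[OF Suc.prems, of i] Suc.IH by metis
  qed
qed (simp add: Ck_conv_0)

lemma C0_conv_const:
  assumes "c \<longlonglongrightarrow> (l::real)"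
  shows "C0_conv U (\<lambda>n _. c n) (\<lambda>_. l)"
proof -
  have "uniform_limit U (\<lambda>n _. c n) (\<lambda>_. l) sequentially"
    unfolding uniform_limit_iff using assms by (auto simp: tendsto_iff elim: eventually_mono)
  then show ?thesis
    by (auto simp: C0_conv_def intro!: finite_imp_bounded finite_subset[of "(\<lambda>_. l) ` U" "{l}"])
qed

lemma Ck_conv_const:
  assumes "c \<longlonglongrightarrow> (l::real)"
  shows "Ck_conv U k (\<lambda>n _. c n) (\<lambda>_. l)"
  using assms
proof (induction k arbitrary: c l)
  case (Suc k)
  have "Ck_conv U k (\<lambda>n _. 0) (\<lambda>_. 0)"
    by (rule Suc.IH) simp
  then show ?case
    by (intro Ck_conv_SucI C0_conv_const[OF Suc.prems] exI[of _ "\<lambda>_ _. 0"] exI[of _ "\<lambda>_. 0"])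
       (simp add: has_partial_const)
qed (simp add: C0_conv_const)

lemma C0_conv_add:
  "C0_conv U gs g \<Longrightarrow> C0_conv U hs h \<Longrightarrow> C0_conv U (\<lambda>n x. gs n x + hs n x) (\<lambda>x. g x + h x)"
  by (auto simp: C0_conv_def intro!: uniform_limit_add continuous_intros bounded_plus_comp)

lemma Ck_conv_add:
  "Ck_conv U k gs g \<Longrightarrow> Ck_conv U k hs h \<Longrightarrow> Ck_conv U k (\<lambda>n x. gs n x + hs n x) (\<lambda>x. g x + h x)"
proof (induction k arbitrary: gs g hs h)
  case (Suc k)
  have "\<exists>f f'. (\<forall>n. has_partial U i (\<lambda>x. gs n x + hs n x) (f n)) \<and>
      has_partial U i (\<lambda>x. g x + h x) f' \<and> Ck_conv U k f f'" for i
  proof -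
    obtain gs' g' where "\<And>n. has_partial U i (gs n) (gs' n)" "has_partial U i g g'" "Ck_conv U k gs' g'"
      using Ck_conv_SucE[OF Suc.prems(1), of i] by blast
    moreover obtain hs' h' where "\<And>n. has_partial U i (hs n) (hs' n)" "has_partial U i h h'" "Ck_conv U k hs' h'"
      using Ck_conv_SucE[OF Suc.prems(2), of i] by blast
    ultimately show ?thesis
      by (intro exI[of _ "\<lambda>n x. gs' n x + hs' n x"] exI[of _ "\<lambda>x. g' x + h' x"] conjI allI has_partial_add Suc.IH)
  qed
  then show ?case
    using Suc.prems by (simp add: C0_conv_add)
qed (simp add: C0_conv_add)

lemma C0_conv_mult:
  assumes "C0_conv U gs g" "C0_conv U hs h"
  shows "C0_conv U (\<lambda>n x. gs n x * hs n x) (\<lambda>x. g x * h x)"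
proof -
  have "bounded ((\<lambda>x. g x * h x) ` U)"
  proof -
    obtain a b where "\<And>x. x \<in> U \<Longrightarrow> \<bar>g x\<bar> \<le> a" "\<And>x. x \<in> U \<Longrightarrow> \<bar>h x\<bar> \<le> b"
      using assms by (auto simp: C0_conv_def bounded_iff)
    then have "\<bar>g x * h x\<bar> \<le> \<bar>a\<bar> * \<bar>b\<bar>" if "x \<in> U" for x
      using that unfolding abs_mult by (intro mult_mono) fastforce+
    then show ?thesis
      by (auto simp: bounded_iff)
  qed
  then show ?thesis
    using assms by (auto simp: C0_conv_def intro!: uniform_lim_mult continuous_intros)
qed

lemma Ck_conv_mult:
  "Ck_conv U k gs g \<Longrightarrow> Ck_conv U k hs h \<Longrightarrow> Ck_conv U k (\<lambda>n x. gs n x * hs n x) (\<lambda>x. g x * h x)"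
proof (induction k arbitrary: gs g hs h)
  case (Suc k)
  have "\<exists>f f'. (\<forall>n. has_partial U i (\<lambda>x. gs n x * hs n x) (f n)) \<and>
      has_partial U i (\<lambda>x. g x * h x) f' \<and> Ck_conv U k f f'" for i
  proof -
    obtain gs' g' where g: "\<And>n. has_partial U i (gs n) (gs' n)" "has_partial U i g g'" "Ck_conv U k gs' g'"
      using Ck_conv_SucE[OF Suc.prems(1), of i] by blast
    obtain hs' h' where h: "\<And>n. has_partial U i (hs n) (hs' n)" "has_partial U i h h'" "Ck_conv U k hs' h'"
      using Ck_conv_SucE[OF Suc.prems(2), of i] by blast
    have "Ck_conv U k (\<lambda>n x. gs' n x * hs n x + gs n x * hs' n x) (\<lambda>x. g' x * h x + g x * h' x)"
      using g h Suc.prems[THEN Ck_conv_SucD] by (intro Ck_conv_add Suc.IH)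
    with g h show ?thesis
      by (intro exI[of _ "\<lambda>n x. gs' n x * hs n x + gs n x * hs' n x"] exI[of _ "\<lambda>x. g' x * h x + g x * h' x"]
          conjI allI has_partial_mult)
  qed
  then show ?case
    using Suc.prems by (simp add: C0_conv_mult)
qed (simp add: C0_conv_mult)

lemma C0_conv_imp_C0_le:
  assumes "C0_conv U gs g" "e > 0"
  shows "\<forall>\<^sub>F n in sequentially. C0_le U e (\<lambda>x. gs n x - g x)"
proof -
  have "\<forall>\<^sub>F n in sequentially. \<forall>x\<in>U. dist (gs n x) (g x) < e"
    using assms by (simp add: C0_conv_def uniform_limit_iff)
  then show ?thesis
    by (rule eventually_mono)
       (use assms(1) in \<open>auto simp: C0_conv_def C0_le_def dist_real_def intro!: continuous_intros less_imp_le\<close>)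
qed

lemma Ck_conv_imp_Ck_le:
  assumes "Ck_conv U k gs g" "e > 0"
  shows "\<forall>\<^sub>F n in sequentially. Ck_le U k e (\<lambda>x. gs n x - g x)"
  using assms(1)
proof (induction k arbitrary: gs g)
  case 0
  then show ?case
    using assms(2) by (simp add: C0_conv_imp_C0_le)
next
  case (Suc k)
  have "\<forall>\<^sub>F n in sequentially. \<exists>f. has_partial U i (\<lambda>x. gs n x - g x) f \<and> Ck_le U k e f" for i
  proof -
    obtain gs' g' where *: "\<And>n. has_partial U i (gs n) (gs' n)" "has_partial U i g g'" "Ck_conv U k gs' g'"
      using Ck_conv_SucE[OF Suc.prems, of i] by blast
    show ?thesis
      using Suc.IH[OF *(3)] by (rule eventually_mono) (use * has_partial_diff in blast)
  qed
  then have "\<forall>\<^sub>F n in sequentially. \<forall>i. \<exists>f. has_partial U i (\<lambda>x. gs n x - g x) f \<and> Ck_le U k e f"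
    by (simp add: eventually_all_finite)
  moreover have "\<forall>\<^sub>F n in sequentially. C0_le U e (\<lambda>x. gs n x - g x)"
    using Suc.prems assms(2) by (simp add: C0_conv_imp_C0_le)
  ultimately show ?case
    by eventually_elim simp
qed

section \<open>Polynomials in several variables with a degree bound\<close>

text \<open>A predicate on functions instead of a type of multivariate polynomials: every fact used
  below, including the approximation by exponential sums, follows by induction on how the polynomial
  is built. The index bounds the total degree.\<close>

inductive poly_deg :: "nat \<Rightarrow> (real^'d::finite \<Rightarrow> real) \<Rightarrow> bool" where
  const: "poly_deg n (\<lambda>_. c)"
| coord: "poly_deg 1 (\<lambda>x. x $ i)"
| add: "poly_deg n p \<Longrightarrow> poly_deg n q \<Longrightarrow> poly_deg n (\<lambda>x. p x + q x)"
| mult: "poly_deg n p \<Longrightarrow> poly_deg m q \<Longrightarrow> poly_deg (n + m) (\<lambda>x. p x * q x)"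
| mono: "poly_deg n p \<Longrightarrow> n \<le> m \<Longrightarrow> poly_deg m p"

lemma poly_deg_diff: "poly_deg n p \<Longrightarrow> poly_deg n q \<Longrightarrow> poly_deg n (\<lambda>x. p x - q x)"
  using poly_deg.add[OF _ poly_deg.mult[OF poly_deg.const[of 0 "-1"]], of n p q] by simp

lemma poly_deg_sum: "(\<And>i. i \<in> S \<Longrightarrow> poly_deg n (p i)) \<Longrightarrow> poly_deg n (\<lambda>x. \<Sum>i\<in>S. p i x)"
  by (induction S rule: infinite_finite_induct) (auto intro: poly_deg.intros)

lemma poly_deg_prod: "(\<And>i. i \<in> S \<Longrightarrow> poly_deg (n i) (p i)) \<Longrightarrow> poly_deg (\<Sum>i\<in>S. n i) (\<lambda>x. \<Prod>i\<in>S. p i x)"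
  by (induction S rule: infinite_finite_induct) (auto intro: poly_deg.intros)

lemma poly_deg_power: "poly_deg n p \<Longrightarrow> poly_deg (k * n) (\<lambda>x. p x ^ k)"
  using poly_deg_prod[of "{..<k}" "\<lambda>_. n" "\<lambda>_. p"] by simp

lemma poly_deg_cmult: "poly_deg n p \<Longrightarrow> poly_deg n (\<lambda>x. c * p x)"
  using poly_deg.mult[OF poly_deg.const[of 0 c]] by simp

lemma poly_deg_continuous_on: "poly_deg n p \<Longrightarrow> continuous_on S p"
  by (induction rule: poly_deg.induct) (auto intro!: continuous_intros)

text \<open>The bound \<open>n\<close> is not lowered by differentiation: later only its growth in
  \<open>s\<close> matters, and truncated subtraction in the product case is avoided.\<close>

lemma poly_deg_has_partial:
  "poly_deg n p \<Longrightarrow> \<exists>p'. poly_deg n p' \<and> has_partial UNIV i p p'"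
proof (induction rule: poly_deg.induct)
  case (const n c)
  then show ?case
    using has_partial_const poly_deg.const by blast
next
  case (coord j)
  then show ?case
    using has_partial_coord poly_deg.const by blast
next
  case (add n p q)
  then show ?case
    using has_partial_add poly_deg.add by blast
next
  case (mult n p m q)
  then show ?case
    using has_partial_mult poly_deg.add poly_deg.mult by blast
next
  case (mono n p m)
  then show ?case
    using poly_deg.mono by blast
qed

text \<open>Along lines parallel to an axis the one-variable Markov inequality becomes
  applicable.\<close>

lemma poly_deg_line:
  "poly_deg n p \<Longrightarrow> \<exists>q :: real poly. degree q \<le> n \<and> (\<forall>t. p (x + t *\<^sub>R axis i 1) = poly q t)"
proof (induction rule: poly_deg.induct)
  case (const n c)
  then show ?case
    by (intro exI[of _ "[:c:]"]) simp
next
  case (coord j)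
  then show ?case
    by (intro exI[of _ "[:x $ j, axis i 1 $ j:]"]) simp
next
  case (add n p q)
  then obtain a b :: "real poly" where "degree a \<le> n" "degree b \<le> n"
    "\<forall>t. p (x + t *\<^sub>R axis i 1) = poly a t" "\<forall>t. q (x + t *\<^sub>R axis i 1) = poly b t"
    by blast
  then show ?case
    by (intro exI[of _ "a + b"]) (simp add: degree_add_le)
next
  case (mult n p m q)
  then obtain a b :: "real poly" where "degree a \<le> n" "degree b \<le> m"
    "\<forall>t. p (x + t *\<^sub>R axis i 1) = poly a t" "\<forall>t. q (x + t *\<^sub>R axis i 1) = poly b t"
    by blast
  then show ?case
    by (intro exI[of _ "a * b"]) (simp add: order.trans[OF degree_mult_le])
next
  case (mono n p m)
  then show ?case
    using order.trans by blast
qed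

section \<open>Polynomial step functions\<close>

text \<open>The probability of more than \<open>n\<close> heads among \<open>2 n + 1\<close> flips of a coin with bias \<open>y\<close>.\<close>

definition majority :: "nat \<Rightarrow> real \<Rightarrow> real" where
  "majority n y = (\<Sum>k=n+1..2*n+1. real ((2*n+1) choose k) * y ^ k * (1 - y) ^ (2*n+1-k))"

text \<open>Exchanging heads and tails; an odd number of flips admits no tie.\<close>

lemma majority_reflect: "majority n y + majority n (1 - y) = 1"
proof -
  let ?t = "\<lambda>y k. real ((2*n+1) choose k) * y ^ k * (1 - y) ^ (2*n+1-k)"
  have "majority n (1 - y) = (\<Sum>k\<in>{..n}. ?t y k)"
    unfolding majority_def
  proof (rule sum.reindex_bij_witness[of _ "\<lambda>k. 2*n+1-k" "\<lambda>k. 2*n+1-k"])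
    fix k assume "k \<in> {n+1..2*n+1}"
    then have "k \<le> 2 * n + 1"
      by simp
    from binomial_symmetric[OF this]
    show "real ((2*n+1) choose (2*n+1-k)) * y ^ (2*n+1-k) * (1 - y) ^ (2*n+1-(2*n+1-k)) =
        real ((2*n+1) choose k) * (1 - y) ^ k * (1 - (1 - y)) ^ (2*n+1-k)"
      using \<open>k \<le> 2 * n + 1\<close> by (simp only: diff_diff_cancel) (simp add: mult_ac)
  qed auto
  then have "majority n y + majority n (1 - y) = (\<Sum>k\<in>{..n} \<union> {n+1..2*n+1}. ?t y k)"
    unfolding majority_def by (subst sum.union_disjoint) auto
  also have "{..n} \<union> {n+1..2*n+1} = {..2*n+1}"
    by auto
  also have "(\<Sum>k\<in>{..2*n+1}. ?t y k) = (y + (1 - y)) ^ (2*n+1)"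
    by (subst binomial_ring) simp
  finally show ?thesis
    by simp
qed

lemma majority_nonneg: "0 \<le> y \<Longrightarrow> y \<le> 1 \<Longrightarrow> 0 \<le> majority n y"
  unfolding majority_def by (intro sum_nonneg mult_nonneg_nonneg zero_le_power) auto

lemma majority_le_1: "0 \<le> y \<Longrightarrow> y \<le> 1 \<Longrightarrow> majority n y \<le> 1"
  using majority_reflect[of n y] majority_nonneg[of "1 - y" n] by simp

text \<open>For \<open>k > n\<close> and \<open>y \<le> 1 - y\<close>, replacing surplus factors
  \<open>y\<close> by \<open>1 - y\<close> only enlarges a term, so each is at most its binomial
  coefficient times \<open>(y * (1 - y)) ^ n\<close>. The coefficients sum to at most
  \<open>2 * 4 ^ n\<close>. Away from \<open>1/2\<close> the base \<open>4 * y * (1 - y)\<close> is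
  below 1.\<close>

lemma majority_le:
  assumes "0 \<le> y" "y \<le> 1/2"
  shows "majority n y \<le> 2 * (4 * y * (1 - y)) ^ n"
proof -
  have "majority n y \<le> (\<Sum>k=n+1..2*n+1. real ((2*n+1) choose k) * (y * (1 - y)) ^ n)"
    unfolding majority_def
  proof (intro sum_mono)
    fix k assume k: "k \<in> {n+1..2*n+1}"
    define j where "j = k - (n + 1)"
    have j: "k = n + 1 + j" "j \<le> n" "2 * n + 1 - k = n - j"
      using k by (auto simp: j_def)
    have "y ^ k * (1 - y) ^ (2*n+1-k) = y ^ (n + 1) * (y ^ j * (1 - y) ^ (n - j))"
      unfolding j(3) by (simp add: j(1) power_add)
    also have "\<dots> \<le> y ^ (n + 1) * ((1 - y) ^ j * (1 - y) ^ (n - j))"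
      using assms by (intro mult_left_mono mult_right_mono power_mono) auto
    also have "\<dots> = y * (y * (1 - y)) ^ n"
      using j(2) by (simp add: power_add[symmetric] power_mult_distrib)
    also have "\<dots> \<le> 1 * (y * (1 - y)) ^ n"
      using assms by (intro mult_right_mono) auto
    finally show "real ((2*n+1) choose k) * y ^ k * (1 - y) ^ (2*n+1-k) \<le> real ((2*n+1) choose k) * (y * (1 - y)) ^ n"
      unfolding mult.assoc by (intro mult_left_mono) auto
  qed
  also have "\<dots> = (\<Sum>k=n+1..2*n+1. real ((2*n+1) choose k)) * (y * (1 - y)) ^ n"
    by (rule sum_distrib_right[symmetric])
  also have "\<dots> \<le> 2 ^ (2 * n + 1) * (y * (1 - y)) ^ n"
  proof (intro mult_right_mono)
    have "(\<Sum>k=n+1..2*n+1. real ((2*n+1) choose k)) \<le> (\<Sum>k\<le>2*n+1. real ((2*n+1) choose k))"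
      by (intro sum_mono2) auto
    also have "\<dots> = 2 ^ (2 * n + 1)"
      using choose_row_sum[of "2*n+1"] by (simp only: of_nat_sum[symmetric]) simp
    finally show "(\<Sum>k=n+1..2*n+1. real ((2*n+1) choose k)) \<le> 2 ^ (2 * n + 1)" .
  qed (use assms in auto)
  also have "\<dots> = 2 * (4 * y * (1 - y)) ^ n"
  proof -
    have "(4 * y * (1 - y)) ^ n = 4 ^ n * (y * (1 - y)) ^ n"
      by (simp only: power_mult_distrib[symmetric] mult.assoc)
    then show ?thesis
      by (simp add: power_mult)
  qed
  finally show ?thesis .
qed

lemma poly_deg_majority:
  assumes "poly_deg 1 l"
  shows "poly_deg (2 * n + 1) (\<lambda>x. majority n (l x))"
  unfolding majority_def
proof (rule poly_deg_sum)
  fix k assume k: "k \<in> {n+1..2*n+1}"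
  have "poly_deg (k * 1 + (2*n+1-k) * 1) (\<lambda>x. l x ^ k * (1 - l x) ^ (2*n+1-k))"
    using assms by (intro poly_deg.mult poly_deg_power poly_deg_diff poly_deg.const)
  moreover have "k * 1 + (2*n+1-k) * 1 = 2*n+1"
    using k by auto
  ultimately show "poly_deg (2*n+1) (\<lambda>x. real ((2*n+1) choose k) * l x ^ k * (1 - l x) ^ (2*n+1-k))"
    using poly_deg_cmult[of "2*n+1" _ "real ((2*n+1) choose k)"] by (simp only: mult.assoc)
qed

text \<open>\<open>majority\<close> is composed with an affine function \<open>l\<close> that
  decreases in \<open>x $ i\<close>, maps \<open>Q\<close> into the unit interval and takes the
  value \<open>1/2\<close> midway between \<open>u\<close> and \<open>v\<close>. The rate
  \<open>\<theta>\<close> is prescribed in advance, since it must beat a growth rate that is given;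
  raising the number of flips by a factor \<open>m\<close> achieves this.\<close>

lemma poly_step:
  fixes Q :: "(real^'d::finite) set"
  assumes "bounded Q" "u < v" "0 < \<theta>" "\<theta> \<le> 1"
  obtains m where "\<And>s. \<exists>z. poly_deg (m * (s + 1)) z \<and> (\<forall>x\<in>Q. 0 \<le> z x \<and> z x \<le> 1) \<and>
    (\<forall>x\<in>Q. x $ i \<le> u \<longrightarrow> 1 - z x \<le> \<theta> ^ (s + 1)) \<and> (\<forall>x\<in>Q. v \<le> x $ i \<longrightarrow> z x \<le> \<theta> ^ (s + 1))"
proof -
  obtain B where B: "\<And>x. x \<in> Q \<Longrightarrow> norm x \<le> B"
    using assms(1) by (auto simp: bounded_iff)
  define c where "c = (u + v) / 2"
  \<comment> \<open>Large enough for \<open>l\<close> to map \<open>Q\<close> into the unit interval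
    and for \<open>\<kappa>\<close> to be nonnegative.\<close>
  define W where "W = \<bar>B\<bar> + \<bar>c\<bar> + (v - u)"
  define l where "l = (\<lambda>x::real^'d. 1 / 2 + (c - x $ i) / (2 * W))"
  \<comment> \<open>The value of \<open>4 * l x * (1 - l x)\<close>, which is
    \<open>1 - ((c - x $ i) / W)^2\<close>, at distance \<open>(v - u) / 2\<close> from the midpoint
    \<open>c\<close>.\<close>
  define \<kappa> where "\<kappa> = 1 - ((v - u) / (2 * W))\<^sup>2"
  have W: "W > 0" "v - u \<le> W"
    using assms(2) by (auto simp: W_def)
  have "0 < (v - u) / (2 * W)" "(v - u) / (2 * W) \<le> 1"
    using W assms(2) by simp_all
  then have "((v - u) / (2 * W))\<^sup>2 \<le> 1" "((v - u) / (2 * W))\<^sup>2 > 0"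
    by (auto simp only: power_le_one zero_less_power less_imp_le)
  then have \<kappa>: "0 \<le> \<kappa>" "\<kappa> < 1"
    unfolding \<kappa>_def by linarith+
  have l01: "0 \<le> l x \<and> l x \<le> 1" if "x \<in> Q" for x
  proof -
    have "\<bar>c - x $ i\<bar> \<le> W"
      using B[OF that] component_le_norm_cart[of x i] assms(2) by (simp add: W_def)
    then show ?thesis
      using W by (auto simp: l_def field_simps)
  qed
  have l\<kappa>: "4 * l x * (1 - l x) \<le> \<kappa>" if "(v - u) / 2 \<le> \<bar>c - x $ i\<bar>" for x
  proof -
    have "4 * l x * (1 - l x) = 1 - ((c - x $ i) / W)\<^sup>2"
      using W by (simp add: l_def power2_eq_square field_simps)
    moreover have "(v - u) / (2 * W) \<le> \<bar>(c - x $ i) / W\<bar>"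
      using divide_right_mono[OF that, of W] W by simp
    then have "((v - u) / (2 * W))\<^sup>2 \<le> ((c - x $ i) / W)\<^sup>2"
      using W assms(2) by (subst abs_le_square_iff[symmetric]) simp
    ultimately show ?thesis
      by (simp add: \<kappa>_def)
  qed
  \<comment> \<open>The half absorbs the factor 2 of \<open>majority_le\<close>.\<close>
  obtain m where m: "\<kappa> ^ m < \<theta> / 2"
    using real_arch_pow_inv[of "\<theta> / 2" \<kappa>] \<kappa> assms(3) by auto
  have pow: "2 * y ^ (m * (s + 1)) \<le> \<theta> ^ (s + 1)" if "0 \<le> y" "y \<le> \<kappa>" for y s
  proof -
    have "y ^ (m * (s + 1)) \<le> (\<kappa> ^ m) ^ (s + 1)"
      unfolding power_mult[symmetric] using that by (intro power_mono)
    also have "\<dots> \<le> (\<theta> / 2) ^ (s + 1)"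
      using m \<kappa> by (intro power_mono) auto
    also have "\<dots> \<le> \<theta> ^ (s + 1) / 2"
      using assms(3) by (simp add: power_divide divide_simps)
    finally show ?thesis
      by simp
  qed
  \<comment> \<open>The degree \<open>2 * m * (s + 1) + 1\<close> is at most
    \<open>(2 * m + 1) * (s + 1)\<close>.\<close>
  show thesis
  proof (rule that[of "2 * m + 1"], intro exI conjI ballI impI)
    fix s
    let ?z = "\<lambda>x. majority (m * (s + 1)) (l x)"
    have "poly_deg 1 l"
    proof -
      have "poly_deg 1 (\<lambda>x. (1 / 2 + c / (2 * W)) + (- 1 / (2 * W)) * x $ i)"
        by (intro poly_deg.add poly_deg.const poly_deg_cmult poly_deg.coord)
      then show ?thesis
        by (simp add: l_def diff_divide_distrib add_diff_eq)
    qed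
    then have "poly_deg (2 * (m * (s + 1)) + 1) ?z"
      by (rule poly_deg_majority)
    then show "poly_deg ((2 * m + 1) * (s + 1)) ?z"
      by (rule poly_deg.mono) (simp add: algebra_simps)
    show "0 \<le> ?z x" "?z x \<le> 1" if "x \<in> Q" for x
      using l01[OF that] by (auto intro: majority_nonneg majority_le_1)
    show "1 - ?z x \<le> \<theta> ^ (s + 1)" if "x \<in> Q" "x $ i \<le> u" for x
    proof -
      have far: "(v - u) / 2 \<le> c - x $ i"
        using that assms(2) by (simp add: c_def field_simps)
      then have "0 \<le> (c - x $ i) / (2 * W)"
        using W assms(2) by auto
      then have "1 - l x \<le> 1 / 2"
        unfolding l_def by linarith
      then have "majority (m * (s + 1)) (1 - l x) \<le> 2 * (4 * (1 - l x) * (1 - (1 - l x))) ^ (m * (s + 1))"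
        using l01[OF that(1)] by (intro majority_le) auto
      also have "\<dots> \<le> \<theta> ^ (s + 1)"
      proof (rule pow)
        have "4 * (1 - l x) * (1 - (1 - l x)) = 4 * l x * (1 - l x)"
          by simp
        also have "\<dots> \<le> \<kappa>"
          using far by (intro l\<kappa>) linarith
        finally show "4 * (1 - l x) * (1 - (1 - l x)) \<le> \<kappa>" .
      qed (use l01[OF that(1)] in auto)
      finally show ?thesis
        using majority_reflect[of "m * (s + 1)" "l x"] by simp
    qed
    show "?z x \<le> \<theta> ^ (s + 1)" if "x \<in> Q" "v \<le> x $ i" for x
    proof -
      have far: "(v - u) / 2 \<le> x $ i - c"
        using that assms(2) by (simp add: c_def field_simps)
      then have "(c - x $ i) / (2 * W) \<le> 0"
        using W assms(2) by (intro divide_nonpos_pos) auto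
      then have "l x \<le> 1 / 2"
        unfolding l_def by linarith
      then have "?z x \<le> 2 * (4 * l x * (1 - l x)) ^ (m * (s + 1))"
        using l01[OF that(1)] by (intro majority_le) auto
      also have "\<dots> \<le> \<theta> ^ (s + 1)"
      proof (rule pow)
        show "4 * l x * (1 - l x) \<le> \<kappa>"
          using far by (intro l\<kappa>) linarith
      qed (use l01[OF that(1)] in auto)
      finally show ?thesis .
    qed
  qed
qed

section \<open>Geometric polynomial approximation on compact sets\<close>

text \<open>The approximation holds on \<open>S\<close>, the growth bound on the larger set
  \<open>Q\<close>: gluing multiplies a polynomial by a step function also where it no longer
  approximates \<open>f\<close>. Fixing the rate \<open>1/2\<close> makes two approximations with
  the same \<open>s\<close> comparable, and gluing does not degrade it.\<close>

definition exp_approx :: "(real^'d::finite) set \<Rightarrow> (real^'d \<Rightarrow> real) \<Rightarrow> (real^'d) set \<Rightarrow> bool" where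
  "exp_approx Q f S \<longleftrightarrow> (\<exists>C K A. C > 0 \<and> K \<ge> 1 \<and> (\<forall>s. \<exists>p. poly_deg (A * (s + 1)) p \<and>
     (\<forall>x\<in>S. \<bar>f x - p x\<bar> \<le> C / 2 ^ s) \<and> (\<forall>x\<in>Q. \<bar>p x\<bar> \<le> C * K ^ s)))"

lemma exp_approx_subset: "exp_approx Q f T \<Longrightarrow> S \<subseteq> T \<Longrightarrow> exp_approx Q f S"
  unfolding exp_approx_def by (meson subset_iff)

lemma exp_approx_larger_constants:
  assumes "poly_deg (A * (s + 1)) p" "\<forall>x\<in>S. \<bar>f x - p x\<bar> \<le> C / 2 ^ s" "\<forall>x\<in>Q. \<bar>p x\<bar> \<le> C * K ^ s"
    and "0 < C" "C \<le> C'" "1 \<le> K" "K \<le> K'" "A \<le> (A'::nat)"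
  shows "poly_deg (A' * (s + 1)) p \<and> (\<forall>x\<in>S. \<bar>f x - p x\<bar> \<le> C' / 2 ^ s) \<and> (\<forall>x\<in>Q. \<bar>p x\<bar> \<le> C' * K' ^ s)"
proof (intro conjI ballI)
  show "poly_deg (A' * (s + 1)) p"
    using assms(1) by (rule poly_deg.mono) (use assms(8) in \<open>rule mult_right_mono; simp\<close>)
  show "\<bar>f x - p x\<bar> \<le> C' / 2 ^ s" if "x \<in> S" for x
    using assms(2) that divide_right_mono[OF assms(5), of "2 ^ s"] by fastforce
  show "\<bar>p x\<bar> \<le> C' * K' ^ s" if "x \<in> Q" for x
  proof -
    have "C * K ^ s \<le> C' * K' ^ s"
      using assms(4-7) by (intro mult_mono power_mono) auto
    then show ?thesis
      using assms(3) that by fastforce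
  qed
qed

text \<open>The glued polynomial is \<open>q + z * (p - q)\<close> with \<open>z\<close> close to 1
  for \<open>x $ i \<le> u\<close> and close to 0 for \<open>v \<le> x $ i\<close>. In the overlap
  it is a convex combination of two good approximations; outside, the polynomial that may be bad
  there has only an exponentially small weight.\<close>

lemma exp_approx_merge:
  assumes "bounded Q" "S \<subseteq> Q" "u < v"
    and "exp_approx Q f (S \<inter> {x. x $ i \<le> v})" and "exp_approx Q f (S \<inter> {x. u \<le> x $ i})"
  shows "exp_approx Q f S"
proof -
  obtain C1 K1 A1 where 1: "C1 > 0" "K1 \<ge> 1" "\<And>s. \<exists>p. poly_deg (A1 * (s + 1)) p \<and>
     (\<forall>x\<in>S \<inter> {x. x $ i \<le> v}. \<bar>f x - p x\<bar> \<le> C1 / 2 ^ s) \<and> (\<forall>x\<in>Q. \<bar>p x\<bar> \<le> C1 * K1 ^ s)"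
    using assms(4) unfolding exp_approx_def by blast
  obtain C2 K2 A2 where 2: "C2 > 0" "K2 \<ge> 1" "\<And>s. \<exists>p. poly_deg (A2 * (s + 1)) p \<and>
     (\<forall>x\<in>S \<inter> {x. u \<le> x $ i}. \<bar>f x - p x\<bar> \<le> C2 / 2 ^ s) \<and> (\<forall>x\<in>Q. \<bar>p x\<bar> \<le> C2 * K2 ^ s)"
    using assms(5) unfolding exp_approx_def by blast
  define C where "C = max C1 C2"
  define K where "K = max K1 K2"
  define A where "A = max A1 A2"
  \<comment> \<open>Then \<open>(\<theta> * K) ^ s\<close> is \<open>1 / 2 ^ s\<close>: the small
    weight turns the growth \<open>K ^ s\<close> into the desired rate.\<close>
  define \<theta> where "\<theta> = 1 / (2 * K)"
  have CK: "C > 0" "K \<ge> 1"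
    using 1 2 by (auto simp: C_def K_def)
  then have \<theta>: "0 < \<theta>" "\<theta> \<le> 1"
    by (auto simp: \<theta>_def field_simps)
  obtain m where m: "\<And>s. \<exists>z. poly_deg (m * (s + 1)) z \<and> (\<forall>x\<in>Q. 0 \<le> z x \<and> z x \<le> 1) \<and>
    (\<forall>x\<in>Q. x $ i \<le> u \<longrightarrow> 1 - z x \<le> \<theta> ^ (s + 1)) \<and> (\<forall>x\<in>Q. v \<le> x $ i \<longrightarrow> z x \<le> \<theta> ^ (s + 1))"
    using poly_step[OF assms(1,3) \<theta>] by metis
  \<comment> \<open>In \<open>3 * C\<close> one part is the error of the good polynomial and two
    parts bound the weighted difference \<open>p - q\<close>.\<close>
  have "\<exists>p. poly_deg ((m + A) * (s + 1)) p \<and> (\<forall>x\<in>S. \<bar>f x - p x\<bar> \<le> (3 * C) / 2 ^ s) \<and>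
      (\<forall>x\<in>Q. \<bar>p x\<bar> \<le> (3 * C) * K ^ s)" for s
  proof -
    obtain p where "poly_deg (A1 * (s + 1)) p" "\<forall>x\<in>S \<inter> {x. x $ i \<le> v}. \<bar>f x - p x\<bar> \<le> C1 / 2 ^ s"
      "\<forall>x\<in>Q. \<bar>p x\<bar> \<le> C1 * K1 ^ s"
      using 1(3) by blast
    from exp_approx_larger_constants[OF this, of C K A] 1
    have p: "poly_deg (A * (s + 1)) p" "\<And>x. x \<in> S \<Longrightarrow> x $ i \<le> v \<Longrightarrow> \<bar>f x - p x\<bar> \<le> C / 2 ^ s"
      "\<And>x. x \<in> Q \<Longrightarrow> \<bar>p x\<bar> \<le> C * K ^ s"
      by (auto simp: C_def K_def A_def)
    obtain q where "poly_deg (A2 * (s + 1)) q" "\<forall>x\<in>S \<inter> {x. u \<le> x $ i}. \<bar>f x - q x\<bar> \<le> C2 / 2 ^ s"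
      "\<forall>x\<in>Q. \<bar>q x\<bar> \<le> C2 * K2 ^ s"
      using 2(3) by blast
    from exp_approx_larger_constants[OF this, of C K A] 2
    have q: "poly_deg (A * (s + 1)) q" "\<And>x. x \<in> S \<Longrightarrow> u \<le> x $ i \<Longrightarrow> \<bar>f x - q x\<bar> \<le> C / 2 ^ s"
      "\<And>x. x \<in> Q \<Longrightarrow> \<bar>q x\<bar> \<le> C * K ^ s"
      by (auto simp: C_def K_def A_def)
    obtain z where z: "poly_deg (m * (s + 1)) z" "\<And>x. x \<in> Q \<Longrightarrow> 0 \<le> z x" "\<And>x. x \<in> Q \<Longrightarrow> z x \<le> 1"
      "\<And>x. x \<in> Q \<Longrightarrow> x $ i \<le> u \<Longrightarrow> 1 - z x \<le> \<theta> ^ (s + 1)"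
      "\<And>x. x \<in> Q \<Longrightarrow> v \<le> x $ i \<Longrightarrow> z x \<le> \<theta> ^ (s + 1)"
      using m[of s] by blast
    define r where "r = (\<lambda>x. q x + z x * (p x - q x))"
    have "poly_deg ((m + A) * (s + 1)) r"
      unfolding r_def
    proof (rule poly_deg.add)
      show "poly_deg ((m + A) * (s + 1)) q"
        using q(1) by (rule poly_deg.mono) (simp add: algebra_simps)
      show "poly_deg ((m + A) * (s + 1)) (\<lambda>x. z x * (p x - q x))"
        unfolding add_mult_distrib using p q z by (intro poly_deg.mult poly_deg_diff)
    qed
    moreover have "\<bar>f x - r x\<bar> \<le> (3 * C) / 2 ^ s" if x: "x \<in> S" for x
    proof -
      have xQ: "x \<in> Q"
        using x assms(2) by blast
      have small: "w * \<bar>p x - q x\<bar> \<le> 2 * (C / 2 ^ s)" if "0 \<le> w" "w \<le> \<theta> ^ (s + 1)" for w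
      proof -
        have "w \<le> \<theta> ^ s"
          using that(2) power_decreasing[of s "s + 1" \<theta>] \<theta> by linarith
        moreover have "\<bar>p x - q x\<bar> \<le> 2 * (C * K ^ s)"
          using p(3)[OF xQ] q(3)[OF xQ] by linarith
        ultimately have "w * \<bar>p x - q x\<bar> \<le> \<theta> ^ s * (2 * (C * K ^ s))"
          using that(1) \<theta> by (intro mult_mono) auto
        also have "\<dots> = 2 * (C * (\<theta> * K) ^ s)"
          by (simp add: power_mult_distrib)
        also have "\<theta> * K = 1 / 2"
          using CK by (simp add: \<theta>_def)
        finally show ?thesis
          by (simp add: power_one_over)
      qed
      consider "x $ i \<le> u" | "u < x $ i" "x $ i < v" | "v \<le> x $ i"
        by linarith
      then show ?thesis
      proof cases
        case 1
        have "f x - r x = (f x - p x) + (1 - z x) * (p x - q x)"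
          by (simp add: r_def algebra_simps)
        also have "\<bar>\<dots>\<bar> \<le> \<bar>f x - p x\<bar> + (1 - z x) * \<bar>p x - q x\<bar>"
          using z(3)[OF xQ] by (intro order.trans[OF abs_triangle_ineq]) (simp add: abs_mult)
        also have "\<dots> \<le> C / 2 ^ s + 2 * (C / 2 ^ s)"
          using 1 assms(3) z xQ by (intro add_mono p small) (auto simp: x)
        finally show ?thesis
          by simp
      next
        case 2
        have "f x - r x = z x * (f x - p x) + (1 - z x) * (f x - q x)"
          by (simp add: r_def algebra_simps)
        also have "\<bar>\<dots>\<bar> \<le> z x * \<bar>f x - p x\<bar> + (1 - z x) * \<bar>f x - q x\<bar>"
          using z(2,3)[OF xQ] by (intro order.trans[OF abs_triangle_ineq]) (simp add: abs_mult)
        also have "\<dots> \<le> z x * (C / 2 ^ s) + (1 - z x) * (C / 2 ^ s)"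
          using 2 z(2,3)[OF xQ] by (intro add_mono mult_left_mono p q x) auto
        also have "\<dots> = C / 2 ^ s"
          by (simp only: distrib_right[symmetric]) simp
        finally show ?thesis
          using CK by (simp add: divide_simps)
      next
        case 3
        have "f x - r x = (f x - q x) - z x * (p x - q x)"
          by (simp add: r_def algebra_simps)
        also have "\<bar>\<dots>\<bar> \<le> \<bar>f x - q x\<bar> + z x * \<bar>p x - q x\<bar>"
          using z(2)[OF xQ] by (intro order.trans[OF abs_triangle_ineq4]) (simp add: abs_mult)
        also have "\<dots> \<le> C / 2 ^ s + 2 * (C / 2 ^ s)"
          using 3 assms(3) z xQ by (intro add_mono q small) (auto simp: x)
        finally show ?thesis
          by simp
      qed
    qed
    moreover have "\<bar>r x\<bar> \<le> (3 * C) * K ^ s" if "x \<in> Q" for x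
    proof -
      have "\<bar>r x\<bar> \<le> \<bar>q x\<bar> + z x * \<bar>p x - q x\<bar>"
        unfolding r_def using z(2)[OF that] by (intro order.trans[OF abs_triangle_ineq]) (simp add: abs_mult)
      also have "\<dots> \<le> \<bar>q x\<bar> + 1 * \<bar>p x - q x\<bar>"
        using z(3)[OF that] by (intro add_left_mono mult_right_mono) auto
      also have "\<dots> \<le> \<bar>q x\<bar> + (\<bar>p x\<bar> + \<bar>q x\<bar>)"
        using abs_triangle_ineq4[of "p x" "q x"] by simp
      also have "\<dots> \<le> C * K ^ s + (C * K ^ s + C * K ^ s)"
        by (intro add_mono p q that)
      finally show ?thesis
        by simp
    qed
    ultimately show ?thesis
      by blast
  qed
  moreover have "3 * C > 0"
    using CK by simp
  ultimately show ?thesis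
    unfolding exp_approx_def using CK(2) by blast
qed

text \<open>Absolute convergence at the corner with offset \<open>h\<close> in every coordinate
  bounds the sum of \<open>\<bar>a \<beta>\<bar> * h ^ sz \<beta>\<close>. At half that offset a
  monomial of total degree above \<open>s\<close> gains a factor \<open>1 / 2 ^ s\<close>; on
  \<open>Q\<close> a monomial exceeds its value at the corner by at most a power of
  \<open>D / h\<close>.\<close>

lemma exp_approx_power_series:
  fixes a :: "('d::finite \<Rightarrow> nat) \<Rightarrow> real"
  assumes "bounded Q" "r > 0"
    and f: "\<And>y. y \<in> ball x r \<Longrightarrow> ((\<lambda>\<beta>. a \<beta> * (\<Prod>i\<in>UNIV. (y $ i - x $ i) ^ \<beta> i)) has_sum f y) UNIV"
  shows "\<exists>\<rho>>0. exp_approx Q f {y. \<forall>i. \<bar>y $ i - x $ i\<bar> < \<rho>}"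
proof -
  \<comment> \<open>By comparison with the l1 norm, offsets up to \<open>h\<close> in all
    coordinates stay within distance \<open>r / 2\<close> of \<open>x\<close>.\<close>
  define h where "h = r / (2 * real CARD('d))"
  have h: "h > 0"
    using assms(2) by (simp add: h_def)
  obtain B where B: "\<And>y. y \<in> Q \<Longrightarrow> norm y \<le> B"
    using assms(1) by (auto simp: bounded_iff)
  \<comment> \<open>The maximum with \<open>h\<close> ensures \<open>D / h \<ge> 1\<close>, so that
    larger exponents give larger powers.\<close>
  define D where "D = max h (\<bar>B\<bar> + norm x)"
  have D: "\<bar>y $ i - x $ i\<bar> \<le> D" if "y \<in> Q" for y i
  proof -
    have "\<bar>y $ i - x $ i\<bar> \<le> norm (y - x)"
      using component_le_norm_cart[of "y - x" i] by simp
    also have "\<dots> \<le> norm y + norm x"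
      by (rule norm_triangle_ineq4)
    also have "\<dots> \<le> D"
      using B[OF that] by (simp add: D_def)
    finally show ?thesis .
  qed
  have Dh: "D \<ge> h"
    by (simp add: D_def)
  define sz where "sz \<beta> = (\<Sum>i\<in>UNIV. \<beta> i)" for \<beta> :: "'d \<Rightarrow> nat"
  have prod_le: "\<bar>\<Prod>i\<in>UNIV. (y $ i - x $ i) ^ \<beta> i\<bar> \<le> t ^ sz \<beta>" if "\<And>i. \<bar>y $ i - x $ i\<bar> \<le> t" for y :: "real^'d" and t \<beta>
    unfolding sz_def abs_prod power_sum power_abs using that by (intro prod_mono) (auto intro!: power_mono)
  have in_ball: "y \<in> ball x r" if "\<And>i. \<bar>y $ i - x $ i\<bar> \<le> h" for y
  proof -
    have "norm (x - y) \<le> (\<Sum>i\<in>UNIV. \<bar>(x - y) $ i\<bar>)"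
      by (rule norm_le_l1_cart)
    also have "\<dots> \<le> (\<Sum>i\<in>(UNIV::'d set). h)"
      using that by (intro sum_mono) (simp add: abs_minus_commute)
    also have "\<dots> < r"
      using assms(2) by (simp add: h_def)
    finally show ?thesis
      by (simp add: dist_norm)
  qed
  have "x + (\<chi> i. h) \<in> ball x r"
    using h by (intro in_ball) simp
  from f[OF this] have "(\<lambda>\<beta>. a \<beta> * (\<Prod>i\<in>UNIV. ((x + (\<chi> i. h)) $ i - x $ i) ^ \<beta> i)) summable_on UNIV"
    by (rule has_sum_imp_summable)
  then have "(\<lambda>\<beta>. a \<beta> * h ^ sz \<beta>) summable_on UNIV"
    by (simp add: sz_def power_sum)
  then have "(\<lambda>\<beta>. norm (a \<beta> * h ^ sz \<beta>)) summable_on UNIV"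
    by (subst (asm) summable_on_iff_abs_summable_on_real)
  then have abs_summ: "(\<lambda>\<beta>. \<bar>a \<beta>\<bar> * h ^ sz \<beta>) summable_on UNIV"
    using h by (simp add: abs_mult)
  \<comment> \<open>Adding 1 keeps \<open>M\<close> positive even if all coefficients
    vanish.\<close>
  define M where "M = (\<Sum>\<^sub>\<infinity>\<beta>. \<bar>a \<beta>\<bar> * h ^ sz \<beta>) + 1"
  have M0: "(\<Sum>\<^sub>\<infinity>\<beta>. \<bar>a \<beta>\<bar> * h ^ sz \<beta>) \<ge> 0"
    using h by (intro infsum_nonneg) auto
  have M: "M > 0"
    using M0 by (simp add: M_def)
  \<comment> \<open>Truncation by the single exponents: inside, the total degree is at most
    \<open>d * s\<close>; outside, some exponent and hence the total degree exceeds
    \<open>s\<close>.\<close>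
  let ?F = "\<lambda>s. PiE UNIV (\<lambda>_::'d. {..s})"
  define p where "p s y = (\<Sum>\<beta>\<in>?F s. a \<beta> * (\<Prod>i\<in>UNIV. (y $ i - x $ i) ^ \<beta> i))" for s and y :: "real^'d"
  define d where "d = CARD('d)"
  have sz_F: "sz \<beta> \<le> d * s" if "\<beta> \<in> ?F s" for \<beta> s
    using that sum_mono[of UNIV \<beta> "\<lambda>_. s"] by (auto simp: sz_def d_def PiE_def Pi_def)
  have "poly_deg (d * (s + 1)) (p s)" for s
    unfolding p_def
  proof (intro poly_deg_sum poly_deg_cmult)
    fix \<beta> assume b: "\<beta> \<in> ?F s"
    have "poly_deg (\<Sum>i\<in>UNIV. \<beta> i * 1) (\<lambda>y. \<Prod>i\<in>UNIV. (y $ i - x $ i) ^ \<beta> i)"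
      by (intro poly_deg_prod poly_deg_power poly_deg_diff poly_deg.coord poly_deg.const)
    then show "poly_deg (d * (s + 1)) (\<lambda>y. \<Prod>i\<in>UNIV. (y $ i - x $ i) ^ \<beta> i)"
      by (rule poly_deg.mono) (use sz_F[OF b] in \<open>simp add: sz_def\<close>)
  qed
  moreover have "\<bar>f y - p s y\<bar> \<le> M / 2 ^ s" if y: "y \<in> {y. \<forall>i. \<bar>y $ i - x $ i\<bar> < h / 2}" for y s
  proof -
    have yi: "\<bar>y $ i - x $ i\<bar> \<le> h / 2" for i
      using y by (simp add: less_imp_le)
    have "\<bar>y $ i - x $ i\<bar> \<le> h" for i
      using yi[of i] h by linarith
    from f[OF in_ball[OF this]]
    have "((\<lambda>\<beta>. a \<beta> * (\<Prod>i\<in>UNIV. (y $ i - x $ i) ^ \<beta> i)) has_sum f y) UNIV" .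
    moreover have "((\<lambda>\<beta>. a \<beta> * (\<Prod>i\<in>UNIV. (y $ i - x $ i) ^ \<beta> i)) has_sum p s y) (?F s)"
      unfolding p_def by (intro has_sum_finite) (simp add: finite_PiE)
    ultimately have tail: "((\<lambda>\<beta>. a \<beta> * (\<Prod>i\<in>UNIV. (y $ i - x $ i) ^ \<beta> i)) has_sum (f y - p s y)) (UNIV - ?F s)"
      by (rule has_sum_Diff) simp
    have "\<bar>f y - p s y\<bar> \<le> (\<Sum>\<^sub>\<infinity>\<beta>\<in>UNIV - ?F s. \<bar>a \<beta>\<bar> * h ^ sz \<beta>) * (1 / 2 ^ s)"
    proof (rule norm_infsum_le[where f = "\<lambda>\<beta>. a \<beta> * (\<Prod>i\<in>UNIV. (y $ i - x $ i) ^ \<beta> i)" and X = "UNIV - ?F s",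
          unfolded real_norm_def])
      show "((\<lambda>\<beta>. a \<beta> * (\<Prod>i\<in>UNIV. (y $ i - x $ i) ^ \<beta> i)) has_sum (f y - p s y)) (UNIV - ?F s)"
        by (rule tail)
      show "((\<lambda>\<beta>. \<bar>a \<beta>\<bar> * h ^ sz \<beta> * (1 / 2 ^ s)) has_sum (\<Sum>\<^sub>\<infinity>\<beta>\<in>UNIV - ?F s. \<bar>a \<beta>\<bar> * h ^ sz \<beta>) * (1 / 2 ^ s)) (UNIV - ?F s)"
        by (intro has_sum_cmult_left has_sum_infsum summable_on_subset_banach[OF abs_summ]) auto
      fix \<beta> assume "\<beta> \<in> UNIV - ?F s"
      then obtain i where "s < \<beta> i"
        by (auto simp: PiE_def Pi_def not_le)
      also have "\<beta> i \<le> sz \<beta>"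
        unfolding sz_def by (rule member_le_sum) auto
      finally have "(1 / 2) ^ sz \<beta> \<le> (1 / 2 :: real) ^ s"
        by (intro power_decreasing) auto
      then have "(h / 2) ^ sz \<beta> \<le> h ^ sz \<beta> * (1 / 2 ^ s)"
        using h by (simp add: power_divide divide_simps)
      then have "\<bar>a \<beta>\<bar> * \<bar>\<Prod>i\<in>UNIV. (y $ i - x $ i) ^ \<beta> i\<bar> \<le> \<bar>a \<beta>\<bar> * (h ^ sz \<beta> * (1 / 2 ^ s))"
        using prod_le[OF yi, of \<beta>] by (intro mult_left_mono) auto
      then show "\<bar>a \<beta> * (\<Prod>i\<in>UNIV. (y $ i - x $ i) ^ \<beta> i)\<bar> \<le> \<bar>a \<beta>\<bar> * h ^ sz \<beta> * (1 / 2 ^ s)"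
        by (simp add: abs_mult mult.assoc)
    qed
    also have "\<dots> \<le> M * (1 / 2 ^ s)"
    proof (intro mult_right_mono)
      have "(\<Sum>\<^sub>\<infinity>\<beta>\<in>UNIV - ?F s. \<bar>a \<beta>\<bar> * h ^ sz \<beta>) \<le> (\<Sum>\<^sub>\<infinity>\<beta>. \<bar>a \<beta>\<bar> * h ^ sz \<beta>)"
        using h by (intro infsum_mono_neutral summable_on_subset_banach[OF abs_summ] abs_summ) auto
      then show "(\<Sum>\<^sub>\<infinity>\<beta>\<in>UNIV - ?F s. \<bar>a \<beta>\<bar> * h ^ sz \<beta>) \<le> M"
        by (simp add: M_def)
    qed auto
    finally show ?thesis
      by simp
  qed
  moreover have "\<bar>p s y\<bar> \<le> M * ((D / h) ^ d) ^ s" if y: "y \<in> Q" for y s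
  proof -
    have "\<bar>p s y\<bar> \<le> (\<Sum>\<beta>\<in>?F s. \<bar>a \<beta>\<bar> * h ^ sz \<beta> * (D / h) ^ (d * s))"
      unfolding p_def
    proof (intro order.trans[OF sum_abs] sum_mono)
      fix \<beta> assume b: "\<beta> \<in> ?F s"
      have "\<bar>\<Prod>i\<in>UNIV. (y $ i - x $ i) ^ \<beta> i\<bar> \<le> D ^ sz \<beta>"
        using D[OF y] by (rule prod_le)
      also have "\<dots> = h ^ sz \<beta> * (D / h) ^ sz \<beta>"
        using h by (simp add: power_divide)
      also have "\<dots> \<le> h ^ sz \<beta> * (D / h) ^ (d * s)"
        using h Dh sz_F[OF b] by (intro mult_left_mono power_increasing) auto
      finally show "\<bar>a \<beta> * (\<Prod>i\<in>UNIV. (y $ i - x $ i) ^ \<beta> i)\<bar> \<le> \<bar>a \<beta>\<bar> * h ^ sz \<beta> * (D / h) ^ (d * s)"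
        unfolding abs_mult mult.assoc by (intro mult_left_mono) auto
    qed
    also have "\<dots> = (\<Sum>\<beta>\<in>?F s. \<bar>a \<beta>\<bar> * h ^ sz \<beta>) * (D / h) ^ (d * s)"
      by (simp add: sum_distrib_right)
    also have "\<dots> \<le> M * (D / h) ^ (d * s)"
    proof (intro mult_right_mono)
      have "(\<Sum>\<beta>\<in>?F s. \<bar>a \<beta>\<bar> * h ^ sz \<beta>) \<le> (\<Sum>\<^sub>\<infinity>\<beta>. \<bar>a \<beta>\<bar> * h ^ sz \<beta>)"
        using h by (intro finite_sum_le_infsum abs_summ) (auto simp: finite_PiE)
      then show "(\<Sum>\<beta>\<in>?F s. \<bar>a \<beta>\<bar> * h ^ sz \<beta>) \<le> M"
        by (simp add: M_def)
    qed (use h Dh in auto)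
    finally show ?thesis
      by (simp add: power_mult)
  qed
  moreover have "(D / h) ^ d \<ge> 1"
    using h Dh by (intro one_le_power) simp
  ultimately have "exp_approx Q f {y. \<forall>i. \<bar>y $ i - x $ i\<bar> < h / 2}"
    unfolding exp_approx_def using M by blast
  then show ?thesis
    using h by (intro exI[of _ "h / 2"]) simp
qed

text \<open>A Lebesgue number of the cover by local domains makes every box with sides at most
  \<open>\<eta>\<close> small enough for one power series. Longer boxes arise by gluing, one
  coordinate direction at a time.\<close>

lemma exp_approx_real_analytic:
  fixes f :: "real^'d::finite \<Rightarrow> real"
  assumes "real_analytic_on f \<Omega>" "compact Q" "Q \<subseteq> \<Omega>"
  shows "exp_approx Q f Q"
\<comment> \<open>The empty set is separated off because the Lebesgue number needs a nonempty
  cover.\<close>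
proof (cases "Q = {}")
  case True
  then show ?thesis
    using poly_deg.const[of _ 0] unfolding exp_approx_def
    by (intro exI[of _ "1 :: real"] exI[of _ "1 :: nat"] conjI allI exI[of _ "\<lambda>_. 0"]) auto
next
  case False
  have Qb: "bounded Q"
    using assms(2) compact_imp_bounded by blast
  have "\<exists>\<rho>>0. exp_approx Q f {y. \<forall>i. \<bar>y $ i - x $ i\<bar> < \<rho>}" if "x \<in> Q" for x
  proof -
    have x: "x \<in> \<Omega>"
      using assms(3) that by blast
    from bspec[OF assms(1)[unfolded real_analytic_on_def] x] show ?thesis
    proof (elim exE conjE)
      fix a r
      assume r: "r > 0" "\<forall>y\<in>ball x r.
        ((\<lambda>\<beta>. a \<beta> * (\<Prod>i\<in>UNIV. (y $ i - x $ i) ^ \<beta> i)) has_sum f y) UNIV"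
      show ?thesis
        by (rule exp_approx_power_series[OF Qb r(1) bspec[OF r(2)]])
    qed
  qed
  then have "\<exists>\<rho>. \<forall>x\<in>Q. \<rho> x > 0 \<and> exp_approx Q f {y. \<forall>i. \<bar>y $ i - x $ i\<bar> < \<rho> x}"
    by (intro bchoice) blast
  then obtain \<rho> where "\<forall>x\<in>Q. \<rho> x > 0 \<and> exp_approx Q f {y. \<forall>i. \<bar>y $ i - x $ i\<bar> < \<rho> x}"
    by (rule exE)
  then have \<rho>: "\<And>x. x \<in> Q \<Longrightarrow> \<rho> x > 0"
    "\<And>x. x \<in> Q \<Longrightarrow> exp_approx Q f {y. \<forall>i. \<bar>y $ i - x $ i\<bar> < \<rho> x}"
    by simp_all
  define V where "V x = {y :: real^'d. \<forall>i. \<bar>y $ i - x $ i\<bar> < \<rho> x}" for x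
  have "V x = (\<Inter>i. {y. \<bar>y $ i - x $ i\<bar> < \<rho> x})" for x
    by (auto simp: V_def)
  then have "open (V x)" for x
    by (auto intro!: open_INT open_Collect_less continuous_intros)
  then have V_open: "B \<in> V ` Q \<Longrightarrow> open B" for B
    by blast
  have "Q \<subseteq> \<Union> (V ` Q)"
    using \<rho>(1) by (auto simp: V_def)
  from Lebesgue_number_lemma[OF assms(2) _ this V_open] False
  obtain \<delta> where \<delta>: "\<delta> > 0" "\<And>T. T \<subseteq> Q \<Longrightarrow> diameter T < \<delta> \<Longrightarrow> \<exists>B\<in>V ` Q. T \<subseteq> B"
    by (metis image_is_empty)
  \<comment> \<open>Boxes with sides at most \<open>\<eta>\<close> have diameter at most
    \<open>\<delta> / 2\<close>, again through the l1 norm.\<close>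
  define \<eta> where "\<eta> = \<delta> / (2 * real CARD('d))"
  have \<eta>: "\<eta> > 0"
    using \<delta>(1) by (simp add: \<eta>_def)
  \<comment> \<open>\<open>I\<close> collects the directions in which the box may be long;
    \<open>I = UNIV\<close> gives all boxes.\<close>
  have "exp_approx Q f (Q \<inter> cbox a b)" if "\<forall>j. j \<notin> I \<longrightarrow> b $ j - a $ j \<le> \<eta>" for I a b
    using finite[of I] that
  proof (induction I arbitrary: a b rule: finite_induct)
    case empty
    have "norm (y - z) \<le> \<delta> / 2" if "y \<in> cbox a b" "z \<in> cbox a b" for y z
    proof -
      have "norm (y - z) \<le> (\<Sum>i\<in>UNIV. \<bar>(y - z) $ i\<bar>)"
        by (rule norm_le_l1_cart)
      also have "\<dots> \<le> (\<Sum>i\<in>(UNIV::'d set). \<eta>)"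
      proof (intro sum_mono)
        fix i
        have "a $ i \<le> y $ i" "y $ i \<le> b $ i" "a $ i \<le> z $ i" "z $ i \<le> b $ i" "b $ i - a $ i \<le> \<eta>"
          using that empty by (auto simp: mem_box_cart)
        then show "\<bar>(y - z) $ i\<bar> \<le> \<eta>"
          unfolding vector_minus_component by linarith
      qed
      also have "\<dots> = \<delta> / 2"
        by (simp add: \<eta>_def)
      finally show ?thesis .
    qed
    then have "diameter (Q \<inter> cbox a b) \<le> \<delta> / 2"
      using \<delta>(1) by (intro diameter_le) (auto simp: dist_norm)
    then obtain x where "x \<in> Q" "Q \<inter> cbox a b \<subseteq> V x"
      using \<delta>(2)[of "Q \<inter> cbox a b"] \<delta>(1) by auto
    then show ?case
      using \<rho>(2)[of x] exp_approx_subset unfolding V_def by blast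
  next
    case (insert i I)
    \<comment> \<open>An inner induction on the length in direction \<open>i\<close>: a slab of
      length \<open>\<eta>\<close> is split off, the rest is shorter by \<open>\<eta> / 2\<close>,
      and the two overlap in the strip of width \<open>\<eta> / 2\<close> that gluing
      requires.\<close>
    have "exp_approx Q f (Q \<inter> cbox a b)"
      if "\<forall>j. j \<notin> insert i I \<longrightarrow> b $ j - a $ j \<le> \<eta>" "b $ i - a $ i \<le> \<eta> + real n * (\<eta> / 2)" for n a b
      using that
    proof (induction n arbitrary: a b)
      case 0
      then show ?case
        by (intro insert.IH) auto
    next
      case (Suc n)
      let ?b = "\<chi> j. if j = i then a $ i + \<eta> else b $ j"
      let ?a = "\<chi> j. if j = i then a $ i + \<eta> / 2 else a $ j"
      show ?case
      proof (rule exp_approx_merge[OF Qb, where i = i and u = "a $ i + \<eta> / 2" and v = "a $ i + \<eta>"])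
        have "exp_approx Q f (Q \<inter> cbox a ?b)"
          using Suc.prems by (intro insert.IH) auto
        then show "exp_approx Q f (Q \<inter> cbox a b \<inter> {x. x $ i \<le> a $ i + \<eta>})"
          by (rule exp_approx_subset) (auto simp: mem_box_cart)
        have "exp_approx Q f (Q \<inter> cbox ?a b)"
          using Suc.prems by (intro Suc.IH) (auto simp: field_simps)
        then show "exp_approx Q f (Q \<inter> cbox a b \<inter> {x. a $ i + \<eta> / 2 \<le> x $ i})"
          by (rule exp_approx_subset) (auto simp: mem_box_cart)
      qed (use \<eta> in auto)
    qed
    moreover obtain n where "(b $ i - a $ i - \<eta>) / (\<eta> / 2) < real n"
      using reals_Archimedean2 by blast
    then have "b $ i - a $ i \<le> \<eta> + real n * (\<eta> / 2)"
      using \<eta> by (simp add: field_simps)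
    ultimately show ?case
      using insert.prems by blast
  qed
  from this[of UNIV] have all: "exp_approx Q f (Q \<inter> cbox a b)" for a b
    by simp
  obtain a b where "Q \<subseteq> cbox a b"
    using bounded_subset_cbox_symmetric[OF Qb] by blast
  then show ?thesis
    using all[of a b] by (simp add: Int_absorb2)
qed

section \<open>Transfer of the geometric rate to derivatives\<close>

lemma Markov_partial:
  fixes U :: "(real^'d::finite) set"
  assumes U: "U = {x. \<forall>i. lo < x $ i \<and> x $ i < hi}" and "lo < hi" and p: "poly_deg n p" "has_partial UNIV i p p'"
    and x: "x \<in> U" and M: "\<And>y. y \<in> U \<Longrightarrow> \<bar>p y\<bar> \<le> M"
  shows "\<bar>p' x\<bar> \<le> 72 * (real n + 1) ^ 3 * M / (hi - lo)"
proof -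
  obtain q :: "real poly" where q: "degree q \<le> n" "\<And>t. p (x + t *\<^sub>R axis i 1) = poly q t"
    using poly_deg_line[OF p(1)] by blast
  \<comment> \<open>From any point of the cube a quarter of the side length is free in the direction
    of the farther face. The point is the endpoint of that segment, and
    \<open>72 = 18 * 4\<close>.\<close>
  define L where "L = (if x $ i \<le> (lo + hi) / 2 then (hi - lo) / 4 else - ((hi - lo) / 4))"
  have xi: "lo < x $ i" "x $ i < hi"
    using x U by auto
  have L: "\<bar>L\<bar> = (hi - lo) / 4" "L \<noteq> 0"
    using assms(2) by (auto simp: L_def)
  have "\<bar>poly q (0 + L * t)\<bar> \<le> M" if t: "0 \<le> t" "t \<le> 1" for t
  proof -
    define e where "e = (hi - lo) / 4 * t"
    have "e \<le> (hi - lo) / 4 * 1"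
      unfolding e_def using t assms(2) by (intro mult_left_mono) auto
    moreover have "0 \<le> e"
      unfolding e_def using t assms(2) by simp
    moreover have "L * t = (if x $ i \<le> (lo + hi) / 2 then e else - e)"
      by (simp add: L_def e_def)
    ultimately have "lo < x $ i + L * t \<and> x $ i + L * t < hi"
      using xi assms(2) by (auto simp: field_simps split: if_splits)
    then have "x + (L * t) *\<^sub>R axis i 1 \<in> U"
      using x by (auto simp: U axis_def)
    from M[OF this] show ?thesis
      by (simp add: q(2))
  qed
  from Markov_endpoint[OF q(1) L(2) this]
  have "\<bar>poly (pderiv q) 0\<bar> \<le> 18 * (real n + 1) ^ 3 * M / ((hi - lo) / 4)"
    by (simp add: L)
  moreover have "((\<lambda>t. p (x + t *\<^sub>R axis i 1)) has_real_derivative p' x) (at 0)"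
    using p(2) by (simp add: has_partial_def)
  then have "p' x = poly (pderiv q) 0"
    unfolding q(2) by (rule DERIV_unique[OF _ poly_DERIV])
  ultimately show ?thesis
    by simp
qed

lemma geometric_limit:
  fixes a :: "nat \<Rightarrow> real"
  assumes \<rho>: "0 < \<rho>" "\<rho> < 1" and a: "\<And>s. \<bar>a (Suc s) - a s\<bar> \<le> C * \<rho> ^ s"
  shows "a \<longlonglongrightarrow> lim a" and "\<bar>lim a - a s\<bar> \<le> C / (1 - \<rho>) * \<rho> ^ s"
proof -
  have "summable (\<lambda>s. C * \<rho> ^ s)"
    using \<rho> by (intro summable_mult summable_geometric) auto
  then have "summable (\<lambda>s. a (Suc s) - a s)"
    by (rule summable_comparison_test'[where N = 0]) (use a in simp)
  then have "convergent (\<lambda>n. \<Sum>s<n. a (Suc s) - a s)"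
    by (simp add: summable_iff_convergent)
  then have "convergent (\<lambda>n. (a n - a 0) + a 0)"
    unfolding sum_lessThan_telescope by (intro convergent_add convergent_const)
  then show lim: "a \<longlonglongrightarrow> lim a"
    by (simp add: convergent_LIMSEQ_iff)
  have C: "C \<ge> 0"
    using a[of 0] by simp
  \<comment> \<open>The factor \<open>1 - \<rho> ^ j\<close> makes the induction close exactly, as
    the partial sum of the geometric series.\<close>
  have bound: "\<bar>a (s + j) - a s\<bar> \<le> C / (1 - \<rho>) * \<rho> ^ s * (1 - \<rho> ^ j)" for j
  proof (induction j)
    case (Suc j)
    have "a (s + Suc j) - a s = (a (Suc (s + j)) - a (s + j)) + (a (s + j) - a s)"
      by simp
    also have "\<bar>\<dots>\<bar> \<le> C * \<rho> ^ (s + j) + C / (1 - \<rho>) * \<rho> ^ s * (1 - \<rho> ^ j)"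
      by (intro order.trans[OF abs_triangle_ineq] add_mono a Suc.IH)
    also have "C * \<rho> ^ (s + j) = C / (1 - \<rho>) * \<rho> ^ s * (\<rho> ^ j * (1 - \<rho>))"
      using \<rho> by (simp add: power_add)
    also have "\<dots> + C / (1 - \<rho>) * \<rho> ^ s * (1 - \<rho> ^ j) = C / (1 - \<rho>) * \<rho> ^ s * (1 - \<rho> ^ Suc j)"
      by (simp only: distrib_left[symmetric]) (simp add: algebra_simps)
    finally show ?case .
  qed simp
  have "(\<lambda>j. a (s + j)) \<longlonglongrightarrow> lim a"
    using LIMSEQ_ignore_initial_segment[OF lim, of s] by (simp add: add.commute)
  then have "(\<lambda>j. \<bar>a (s + j) - a s\<bar>) \<longlonglongrightarrow> \<bar>lim a - a s\<bar>"
    by (intro tendsto_intros)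
  then show "\<bar>lim a - a s\<bar> \<le> C / (1 - \<rho>) * \<rho> ^ s"
  proof (rule LIMSEQ_le_const2, intro exI allI impI)
    fix j
    have "C / (1 - \<rho>) * \<rho> ^ s * (1 - \<rho> ^ j) \<le> C / (1 - \<rho>) * \<rho> ^ s * 1"
      using C \<rho> by (intro mult_left_mono) auto
    then show "\<bar>a (s + j) - a s\<bar> \<le> C / (1 - \<rho>) * \<rho> ^ s"
      using bound[of j] by simp
  qed
qed

text \<open>With \<open>y\<close> the fourth root of \<open>\<rho>\<close>, three factors
  \<open>y ^ s\<close> absorb the cube and the fourth is the new rate. The number
  \<open>A * (s + 2)\<close> is the degree bound for \<open>G (Suc s) - G s\<close> in the
  application.\<close>

lemma cubic_times_geometric:
  fixes \<rho> :: real
  assumes "0 < \<rho>" "\<rho> < 1"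
  obtains C \<rho>' where "C > 0" "0 < \<rho>'" "\<rho>' < 1" "\<And>s. (real (A * (s + 2)) + 1) ^ 3 * \<rho> ^ s \<le> C * \<rho>' ^ s"
proof -
  define y where "y = root 4 \<rho>"
  have y: "0 < y" "y < 1" "y ^ 4 = \<rho>"
    using assms by (simp_all add: y_def)
  have "(\<lambda>n. real n * y ^ n) \<longlonglongrightarrow> 0"
    using y by (intro powser_times_n_limit_0) auto
  then have "Bseq (\<lambda>n. real n * y ^ n)"
    by (intro convergent_imp_Bseq convergentI)
  then obtain B where B: "B > 0" "\<And>n. real n * y ^ n \<le> B"
    unfolding Bseq_def by (auto simp: abs_le_iff)
  have "(real (A * (s + 2)) + 1) ^ 3 * \<rho> ^ s \<le> ((2 * real A + 1) * B / y) ^ 3 * y ^ s" for s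
  proof -
    have "real (A * (s + 2)) + 1 \<le> (2 * real A + 1) * real (s + 1)"
      by (simp add: algebra_simps)
    then have "(real (A * (s + 2)) + 1) * y ^ s \<le> (2 * real A + 1) * real (s + 1) * y ^ s"
      using y by (intro mult_right_mono) auto
    also have "\<dots> = (2 * real A + 1) * (real (s + 1) * y ^ (s + 1)) / y"
      using y by simp
    also have "\<dots> \<le> (2 * real A + 1) * B / y"
      using y B(2)[of "s + 1"] by (intro divide_right_mono mult_left_mono) auto
    finally have "((real (A * (s + 2)) + 1) * y ^ s) ^ 3 \<le> ((2 * real A + 1) * B / y) ^ 3"
      using y by (intro power_mono) auto
    then have "((real (A * (s + 2)) + 1) * y ^ s) ^ 3 * y ^ s \<le> ((2 * real A + 1) * B / y) ^ 3 * y ^ s"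
      using y by (intro mult_right_mono) auto
    moreover have "\<rho> ^ s = (y ^ s) ^ 3 * y ^ s"
      by (simp add: y(3)[symmetric] power_mult[symmetric] power_add[symmetric] mult.commute)
    ultimately show ?thesis
      by (simp add: power_mult_distrib mult.assoc)
  qed
  moreover have "((2 * real A + 1) * B / y) ^ 3 > 0"
    using B y by (intro zero_less_power divide_pos_pos mult_pos_pos) auto
  ultimately show thesis
    using y that by blast
qed

text \<open>Along a short segment in direction \<open>i\<close> this is the one-variable theorem on
  limits of differentiable functions: uniform convergence of the derivatives together with pointwise
  convergence of the functions.\<close>

lemma has_partial_limit:
  assumes "open U" "\<And>n. has_partial U i (G n) (G' n)"
    and unif: "\<And>e. e > 0 \<Longrightarrow> \<forall>\<^sub>F n in sequentially. \<forall>x\<in>U. \<bar>G' n x - g x\<bar> \<le> e"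
    and lim: "\<And>x. x \<in> U \<Longrightarrow> (\<lambda>n. G n x) \<longlonglongrightarrow> f x"
  shows "has_partial U i f g"
  unfolding has_partial_def
proof
  fix x assume x: "x \<in> U"
  obtain e where e: "e > 0" "\<And>t. \<bar>t\<bar> < e \<Longrightarrow> x + t *\<^sub>R axis i 1 \<in> U"
    using line_in_open[OF assms(1) x] by blast
  let ?l = "\<lambda>t. x + t *\<^sub>R axis i 1"
  let ?S = "{-e<..<e}"
  have lU: "?l t \<in> U" if "t \<in> ?S" for t
    using that by (intro e(2)) auto
  have "\<exists>h. \<forall>t\<in>?S. (\<lambda>n. G n (?l t)) \<longlonglongrightarrow> h t \<and> (h has_derivative (*) (g (?l t))) (at t within ?S)"
  proof (rule has_derivative_sequence)
    fix n t assume t: "t \<in> ?S"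
    have "((\<lambda>s. G n (?l t + s *\<^sub>R axis i 1)) has_real_derivative G' n (?l t)) (at 0)"
      using assms(2) lU[OF t] by (simp add: has_partial_def)
    then have "((\<lambda>s. G n (?l (t + s))) has_real_derivative G' n (?l t)) (at 0)"
      by (simp add: scaleR_add_left add.assoc)
    then have "((\<lambda>t. G n (?l t)) has_real_derivative G' n (?l t)) (at t)"
      using DERIV_at_within_shift[of "\<lambda>t. G n (?l t)" "G' n (?l t)" t 0 UNIV] by simp
    then show "((\<lambda>t. G n (?l t)) has_derivative (*) (G' n (?l t))) (at t within ?S)"
      by (simp add: has_field_derivative_def has_derivative_at_withinI)
  next
    fix r :: real assume "r > 0"
    from unif[OF this] show "\<forall>\<^sub>F n in sequentially. \<forall>t\<in>?S. \<forall>h. norm (G' n (?l t) * h - g (?l t) * h) \<le> r * norm h"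
      by eventually_elim
         (auto simp: left_diff_distrib[symmetric] abs_mult intro!: mult_right_mono lU)
  next
    show "(\<lambda>n. G n (?l 0)) \<longlonglongrightarrow> f x"
      using lim[OF x] by simp
  qed (use e in auto)
  then obtain h where "\<forall>t\<in>?S. (\<lambda>n. G n (?l t)) \<longlonglongrightarrow> h t \<and> (h has_derivative (*) (g (?l t))) (at t within ?S)"
    by (rule exE)
  then have h: "\<And>t. t \<in> ?S \<Longrightarrow> (\<lambda>n. G n (?l t)) \<longlonglongrightarrow> h t"
      "\<And>t. t \<in> ?S \<Longrightarrow> (h has_derivative (*) (g (?l t))) (at t within ?S)"
    by simp_all
  have "h t = f (?l t)" if "t \<in> ?S" for t
    using LIMSEQ_unique[OF h(1)[OF that] lim[OF lU[OF that]]] .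
  moreover have "(h has_real_derivative g x) (at 0)"
    using h(2)[of 0] e(1) at_within_open[of 0 ?S] by (simp add: has_field_derivative_def)
  ultimately show "((\<lambda>t. f (?l t)) has_real_derivative g x) (at 0)"
    using e(1) by (auto intro: has_field_derivative_transform_within_open[where S = ?S])
qed

lemma open_cube: "open {x::real^'d::finite. \<forall>i. lo < x $ i \<and> x $ i < hi}"
proof -
  have "{x::real^'d. \<forall>i. lo < x $ i \<and> x $ i < hi} = (\<Inter>i. {x. lo < x $ i} \<inter> {x. x $ i < hi})"
    by auto
  then show ?thesis
    by (auto intro!: open_INT open_Int open_Collect_less continuous_intros)
qed

text \<open>The estimate makes \<open>f\<close> a uniform limit of polynomials, and this yields its
  continuity on \<open>U\<close>.\<close>

lemma C0_le_geometric:
  fixes U :: "(real^'d::finite) set"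
  assumes "\<And>s. poly_deg (n s) (G s)" "0 < \<rho>" "\<rho> < 1"
    and f: "\<And>s x. x \<in> U \<Longrightarrow> \<bar>f x - G s x\<bar> \<le> C * \<rho> ^ s"
  shows "C0_le U (C * \<rho> ^ s) (\<lambda>x. f x - G s x)"
proof -
  have "uniform_limit U G f sequentially"
  proof (rule uniform_limitI)
    fix e :: real assume "e > 0"
    moreover have "(\<lambda>s. C * \<rho> ^ s) \<longlonglongrightarrow> 0"
      using assms by (intro tendsto_mult_right_zero LIMSEQ_power_zero) auto
    ultimately have "\<forall>\<^sub>F s in sequentially. C * \<rho> ^ s < e"
      by (intro order_tendstoD)
    then show "\<forall>\<^sub>F s in sequentially. \<forall>x\<in>U. dist (G s x) (f x) < e"
    proof eventually_elim
      case (elim s)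
      then show ?case
        using f[of _ s] by (force simp: dist_real_def abs_minus_commute)
    qed
  qed
  then have "continuous_on U f"
    by (rule uniform_limit_theorem[rotated]) (auto intro!: always_eventually poly_deg_continuous_on[OF assms(1)])
  then show ?thesis
    using f poly_deg_continuous_on[OF assms(1)] by (auto simp: C0_le_def intro!: continuous_intros)
qed

text \<open>Markov's inequality, applied to \<open>G (s + 1) - G s\<close>, transfers the geometric rate to the derivatives.\<close>

lemma partial_geometric:
  fixes U :: "(real^'d::finite) set"
  assumes U: "U = {x. \<forall>i. lo < x $ i \<and> x $ i < hi}" and lohi: "lo < hi"
    and G: "\<And>s. poly_deg (A * (s + 1)) (G s)" and \<rho>: "0 < \<rho>" "\<rho> < 1"
    and f: "\<And>s x. x \<in> U \<Longrightarrow> \<bar>f x - G s x\<bar> \<le> C * \<rho> ^ s"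
  obtains g G' C' \<rho>' where "\<And>s. poly_deg (A * (s + 1)) (G' s)" "0 < \<rho>'" "\<rho>' < 1"
    "\<And>s x. x \<in> U \<Longrightarrow> \<bar>g x - G' s x\<bar> \<le> C' * \<rho>' ^ s"
    "has_partial U i f g" "\<And>s. has_partial U i (G s) (G' s)"
proof -
  have "\<exists>G'. \<forall>s. poly_deg (A * (s + 1)) (G' s) \<and> has_partial UNIV i (G s) (G' s)"
    using poly_deg_has_partial[OF G] by (intro choice) blast
  then obtain G' where G': "\<And>s. poly_deg (A * (s + 1)) (G' s)" "\<And>s. has_partial UNIV i (G s) (G' s)"
    by blast
  obtain C1 \<rho>' where C1: "C1 > 0" "0 < \<rho>'" "\<rho>' < 1"
    "\<And>s. (real (A * (s + 2)) + 1) ^ 3 * \<rho> ^ s \<le> C1 * \<rho>' ^ s"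
    using cubic_times_geometric[OF \<rho>] by blast
  \<comment> \<open>\<open>144 = 72 * 2\<close>: Markov's constant, and a factor 2 from comparing
    both \<open>G s\<close> and \<open>G (Suc s)\<close> with \<open>f\<close>.\<close>
  define D where "D = 144 * C * C1 / (hi - lo)"
  \<comment> \<open>The derivative is constructed as the limit of the \<open>G' s\<close>; that it
    is the partial derivative of \<open>f\<close> comes out of
    \<open>has_partial_limit\<close>.\<close>
  define g where "g x = lim (\<lambda>s. G' s x)" for x
  have step: "\<bar>G' (Suc s) x - G' s x\<bar> \<le> D * \<rho>' ^ s" if x: "x \<in> U" for x s
  proof -
    have C: "C \<ge> 0"
      using f[OF x, of 0] by simp
    have "\<bar>G (Suc s) y - G s y\<bar> \<le> 2 * C * \<rho> ^ s" if "y \<in> U" for y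
    proof -
      have "G (Suc s) y - G s y = (f y - G s y) - (f y - G (Suc s) y)"
        by simp
      also have "\<bar>\<dots>\<bar> \<le> C * \<rho> ^ s + C * \<rho> ^ Suc s"
        by (intro order.trans[OF abs_triangle_ineq4] add_mono f that)
      also have "\<rho> ^ Suc s \<le> \<rho> ^ s"
        using \<rho> by (intro power_decreasing) auto
      then have "C * \<rho> ^ s + C * \<rho> ^ Suc s \<le> C * \<rho> ^ s + C * \<rho> ^ s"
        using C by (intro add_left_mono mult_left_mono)
      finally show ?thesis
        by simp
    qed
    moreover have "poly_deg (A * (s + 2)) (\<lambda>x. G (Suc s) x - G s x)"
      using G[of "Suc s"] poly_deg.mono[OF G[of s], of "A * (s + 2)"] by (intro poly_deg_diff) auto
    ultimately have "\<bar>G' (Suc s) x - G' s x\<bar> \<le> 72 * (real (A * (s + 2)) + 1) ^ 3 * (2 * C * \<rho> ^ s) / (hi - lo)"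
      using has_partial_diff[OF G'(2) G'(2)] by (intro Markov_partial[OF U lohi _ _ x])
    also have "\<dots> = 144 * C / (hi - lo) * ((real (A * (s + 2)) + 1) ^ 3 * \<rho> ^ s)"
      by simp
    also have "\<dots> \<le> 144 * C / (hi - lo) * (C1 * \<rho>' ^ s)"
      using C lohi by (intro mult_left_mono C1) auto
    finally show ?thesis
      by (simp add: D_def)
  qed
  have g: "\<bar>g x - G' s x\<bar> \<le> D / (1 - \<rho>') * \<rho>' ^ s" if "x \<in> U" for x s
    unfolding g_def using C1(2,3) step[OF that] by (rule geometric_limit(2))
  have "has_partial U i f g"
  proof (rule has_partial_limit)
    show "open U"
      unfolding U by (rule open_cube)
    show "has_partial U i (G n) (G' n)" for n
      using G'(2) by (simp add: has_partial_def)
    show "\<forall>\<^sub>F n in sequentially. \<forall>x\<in>U. \<bar>G' n x - g x\<bar> \<le> e" if "e > 0" for e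
    proof -
      have "(\<lambda>s. D / (1 - \<rho>') * \<rho>' ^ s) \<longlonglongrightarrow> 0"
        using C1 by (intro tendsto_mult_right_zero LIMSEQ_power_zero) auto
      then have "\<forall>\<^sub>F s in sequentially. D / (1 - \<rho>') * \<rho>' ^ s < e"
        using that by (intro order_tendstoD)
      then show ?thesis
      proof eventually_elim
        case (elim s)
        then show ?case
          using g[of _ s] by (force simp: abs_minus_commute)
      qed
    qed
    show "(\<lambda>n. G n x) \<longlonglongrightarrow> f x" if "x \<in> U" for x
    proof -
      have "(\<lambda>s. C * \<rho> ^ s) \<longlonglongrightarrow> 0"
        using \<rho> by (intro tendsto_mult_right_zero LIMSEQ_power_zero) auto
      then have "(\<lambda>s. f x - G s x) \<longlonglongrightarrow> 0"
        by (rule Lim_null_comparison[rotated]) (use f[OF that] in auto)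
      from tendsto_diff[OF tendsto_const[of "f x"] this] show ?thesis
        by simp
    qed
  qed
  moreover have "has_partial U i (G s) (G' s)" for s
    using G'(2) by (simp add: has_partial_def)
  ultimately show thesis
    using G'(1) C1(2,3) g by (intro that)
qed

text \<open>One sequence \<open>G\<close> serves all orders: its derivatives satisfy the same degree
  bounds and approximate the derivatives of \<open>f\<close>, only with a worse rate, so the
  induction on \<open>k\<close> ranges over all \<open>f\<close>, \<open>G\<close>, \<open>C\<close>
  and \<open>\<rho>\<close>.\<close>

lemma Ck_le_geometric:
  fixes U :: "(real^'d::finite) set"
  assumes U: "U = {x. \<forall>i. lo < x $ i \<and> x $ i < hi}" and lohi: "lo < hi"
    and "\<And>s. poly_deg (A * (s + 1)) (G s)" "0 < \<rho>" "\<rho> < 1"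
    and "\<And>s x. x \<in> U \<Longrightarrow> \<bar>f x - G s x\<bar> \<le> C * \<rho> ^ s"
  shows "\<exists>C' \<rho>'. 0 < \<rho>' \<and> \<rho>' < 1 \<and> (\<forall>s. Ck_le U k (C' * \<rho>' ^ s) (\<lambda>x. f x - G s x))"
  using assms(3-6)
proof (induction k arbitrary: f G C \<rho>)
  case (0 f G C \<rho>)
  have "Ck_le U 0 (C * \<rho> ^ s) (\<lambda>x. f x - G s x)" for s
    unfolding Ck_le.simps using 0 by (rule C0_le_geometric)
  then show ?case
    using 0(2,3) by blast
next
  case (Suc k f G C \<rho>)
  note prems = Suc.prems
  have "\<exists>C' \<rho>'. 0 < \<rho>' \<and> \<rho>' < 1 \<and> (\<forall>s. \<exists>h. has_partial U i (\<lambda>x. f x - G s x) h \<and> Ck_le U k (C' * \<rho>' ^ s) h)" for i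
  proof -
    obtain g G' C1 \<rho>1 where 1: "\<And>s. poly_deg (A * (s + 1)) (G' s)" "0 < \<rho>1" "\<rho>1 < 1"
      "\<And>s x. x \<in> U \<Longrightarrow> \<bar>g x - G' s x\<bar> \<le> C1 * \<rho>1 ^ s"
      "has_partial U i f g" "\<And>s. has_partial U i (G s) (G' s)"
      using partial_geometric[OF U lohi prems] by metis
    from Suc.IH[OF 1(1-4)] has_partial_diff[OF 1(5,6)] show ?thesis
      by blast
  qed
  then have "\<exists>C'. \<forall>i. \<exists>\<rho>'. 0 < \<rho>' \<and> \<rho>' < 1 \<and>
      (\<forall>s. \<exists>h. has_partial U i (\<lambda>x. f x - G s x) h \<and> Ck_le U k (C' i * \<rho>' ^ s) h)"
    by (intro choice allI)
  then obtain C' where "\<forall>i. \<exists>\<rho>'. 0 < \<rho>' \<and> \<rho>' < 1 \<and>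
      (\<forall>s. \<exists>h. has_partial U i (\<lambda>x. f x - G s x) h \<and> Ck_le U k (C' i * \<rho>' ^ s) h)"
    by (rule exE)
  then have "\<exists>\<rho>'. \<forall>i. 0 < \<rho>' i \<and> \<rho>' i < 1 \<and>
      (\<forall>s. \<exists>h. has_partial U i (\<lambda>x. f x - G s x) h \<and> Ck_le U k (C' i * \<rho>' i ^ s) h)"
    by (rule choice)
  then obtain \<rho>' where \<rho>': "\<forall>i. 0 < \<rho>' i \<and> \<rho>' i < 1 \<and>
      (\<forall>s. \<exists>h. has_partial U i (\<lambda>x. f x - G s x) h \<and> Ck_le U k (C' i * \<rho>' i ^ s) h)"
    by (rule exE)
  define C2 where "C2 = \<bar>C\<bar> + (\<Sum>i\<in>UNIV. \<bar>C' i\<bar>)"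
  \<comment> \<open>There are finitely many directions, so the slowest rate and the sum of the
    constants serve all of them.\<close>
  define \<rho>2 where "\<rho>2 = Max (insert \<rho> (range \<rho>'))"
  have \<rho>2: "0 < \<rho>2" "\<rho>2 < 1" "\<rho> \<le> \<rho>2" "\<And>i. \<rho>' i \<le> \<rho>2"
    using prems(2,3) \<rho>' by (auto simp: \<rho>2_def Max_gr_iff simp del: Max_insert)
  have C2: "C \<le> C2" "0 \<le> C2" "C' i \<le> C2" for i
  proof -
    have "\<bar>C' i\<bar> \<le> (\<Sum>i\<in>UNIV. \<bar>C' i\<bar>)"
      by (rule member_le_sum) auto
    then show "C' i \<le> C2"
      unfolding C2_def by linarith
    have "0 \<le> (\<Sum>i\<in>UNIV. \<bar>C' i\<bar>)"
      by (intro sum_nonneg) auto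
    then show "C \<le> C2" "0 \<le> C2"
      unfolding C2_def by linarith+
  qed
  have le: "c * r ^ s \<le> C2 * \<rho>2 ^ s" if "c \<le> C2" "0 < r" "r \<le> \<rho>2" for c r s
    using that C2(2) by (intro mult_mono power_mono) auto
  have "Ck_le U (Suc k) (C2 * \<rho>2 ^ s) (\<lambda>x. f x - G s x)" for s
    unfolding Ck_le.simps
  proof (intro conjI allI)
    have "Ck_le U 0 (C * \<rho> ^ s) (\<lambda>x. f x - G s x)"
      unfolding Ck_le.simps using prems by (rule C0_le_geometric)
    then have "Ck_le U 0 (C2 * \<rho>2 ^ s) (\<lambda>x. f x - G s x)"
      by (rule Ck_le_mono) (use C2 \<rho>2 prems in \<open>auto intro: le\<close>)
    then show "C0_le U (C2 * \<rho>2 ^ s) (\<lambda>x. f x - G s x)"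
      by simp
    fix i
    obtain h where h: "has_partial U i (\<lambda>x. f x - G s x) h" "Ck_le U k (C' i * \<rho>' i ^ s) h"
      using \<rho>' by blast
    have "Ck_le U k (C2 * \<rho>2 ^ s) h"
      using h(2) by (rule Ck_le_mono) (use C2 \<rho>2 \<rho>' in \<open>auto intro: le\<close>)
    with h(1) show "\<exists>g'. has_partial U i (\<lambda>x. f x - G s x) g' \<and> Ck_le U k (C2 * \<rho>2 ^ s) g'"
      by blast
  qed
  then show ?case
    using \<rho>2(1,2) by blast
qed

section \<open>Exponentials and coordinates as limits of rescaled functions\<close>

text \<open>Up to an affine map a \<open>tanh\<close> neuron, with \<open>exp\<close> as its limit for \<open>n \<longlonglongrightarrow> \<infinity>\<close>.\<close>

definition shifted_logistic :: "nat \<Rightarrow> real \<Rightarrow> real" where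
  "shifted_logistic n v = exp (2 * real n) * (1 + tanh (v / 2 - real n)) / 2"

lemma shifted_logistic_eq: "shifted_logistic n v = exp v / (1 + exp v * exp (- 2 * real n))"
proof -
  define a b where "a = exp v" and "b = exp (2 * real n)"
  have ab: "a > 0" "b > 0"
    by (simp_all add: a_def b_def)
  have "exp (- 2 * (v / 2 - real n)) = b / a"
    by (simp add: a_def b_def exp_diff[symmetric])
  then have "tanh (v / 2 - real n) = (1 - b / a) / (1 + b / a)"
    by (simp add: tanh_real_altdef)
  then have "shifted_logistic n v = b * (1 + (1 - b / a) / (1 + b / a)) / 2"
    by (simp add: shifted_logistic_def b_def)
  also have "\<dots> = a / (1 + a / b)"
    using ab add_pos_pos[OF ab] by (simp add: divide_simps)
  finally show ?thesis
    by (simp add: a_def b_def exp_minus divide_inverse)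
qed

text \<open>The logistic equation: the derivative is a polynomial in the function itself, with a
  quadratic coefficient that tends to 0. Higher derivatives are thus reached by sums and products
  alone.\<close>

lemma DERIV_shifted_logistic:
  "(shifted_logistic n has_real_derivative
     shifted_logistic n v * (1 + - exp (- 2 * real n) * shifted_logistic n v)) (at v)"
proof -
  define b where "b = exp (- 2 * real n)"
  have b: "b > 0"
    by (simp add: b_def)
  have "1 + exp v * b > 0"
    using b by (intro add_pos_pos) auto
  then have "((\<lambda>v. exp v / (1 + exp v * b)) has_real_derivative
      exp v / (1 + exp v * b) * (1 + - b * (exp v / (1 + exp v * b)))) (at v)"
    by (auto intro!: derivative_eq_intros simp: divide_simps) (auto simp: algebra_simps)
  then show ?thesis
    unfolding shifted_logistic_eq[abs_def] b_def .
qed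

lemma shifted_logistic_error: "\<bar>shifted_logistic n v - exp v\<bar> \<le> exp (2 * v) * exp (- 2 * real n)"
proof -
  define a b where "a = exp v" and "b = exp (- 2 * real n)"
  have ab: "a > 0" "b > 0"
    by (simp_all add: a_def b_def)
  have "shifted_logistic n v - exp v = - (a * a * b / (1 + a * b))"
    using add_pos_pos[OF zero_less_one mult_pos_pos[OF ab]]
    unfolding shifted_logistic_eq a_def[symmetric] b_def[symmetric]
    by (simp add: divide_simps) (simp add: algebra_simps)
  also have "\<bar>\<dots>\<bar> = a * a * b / (1 + a * b)"
    using ab by (simp add: abs_mult add_pos_pos)
  also have "\<dots> \<le> a * a * b / 1"
    using ab by (intro divide_left_mono) (auto simp: add_pos_pos)
  also have "a * a = exp (2 * v)"
    by (simp add: a_def exp_add[symmetric])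
  finally show ?thesis
    by (simp add: b_def)
qed

text \<open>As \<open>v\<close> is bounded, all arguments eventually lie in one compact interval,
  where \<open>exp\<close> is uniformly continuous and the error decays like
  \<open>exp (- 2 * real n)\<close>.\<close>

lemma C0_conv_shifted_logistic:
  assumes "C0_conv U vs v"
  shows "C0_conv U (\<lambda>n x. shifted_logistic n (vs n x)) (\<lambda>x. exp (v x))"
proof -
  obtain M where M: "\<And>x. x \<in> U \<Longrightarrow> \<bar>v x\<bar> \<le> M"
    using assms by (auto simp: C0_conv_def bounded_iff)
  have "\<forall>\<^sub>F n in sequentially. \<forall>x\<in>U. dist (vs n x) (v x) < 1"
    using assms by (simp add: C0_conv_def uniform_limit_iff)
  then have ev: "\<forall>\<^sub>F n in sequentially. \<forall>x\<in>U. \<bar>vs n x\<bar> \<le> M + 1"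
  proof eventually_elim
    case (elim n)
    show ?case
    proof
      fix x assume x: "x \<in> U"
      then have "\<bar>vs n x - v x\<bar> < 1"
        using elim by (simp add: dist_real_def)
      then show "\<bar>vs n x\<bar> \<le> M + 1"
        using M[OF x] by linarith
    qed
  qed
  have "uniform_limit U (\<lambda>n x. exp (vs n x)) (\<lambda>x. exp (v x)) sequentially"
  proof (rule uniform_limit_compose_uniformly_continuous_on[where f = exp and g = vs and g' = v])
    show "uniform_limit U vs v sequentially"
      using assms by (simp add: C0_conv_def)
    show "uniformly_continuous_on {-(M+1)..M+1} (exp :: real \<Rightarrow> real)"
      by (intro compact_uniformly_continuous continuous_intros) auto
    show "\<forall>\<^sub>F n in sequentially. \<forall>x\<in>U. vs n x \<in> {-(M+1)..M+1}"
      using ev by eventually_elim (auto simp: abs_le_iff minus_le_iff)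
  qed auto
  moreover have "uniform_limit U (\<lambda>n x. shifted_logistic n (vs n x) - exp (vs n x)) (\<lambda>_. 0) sequentially"
  proof (rule uniform_limitI)
    fix e :: real assume "e > 0"
    moreover have "(\<lambda>n. exp (2 * (M + 1)) * exp (- 2 * real n)) \<longlonglongrightarrow> 0"
      by real_asymp
    ultimately have "\<forall>\<^sub>F n in sequentially. exp (2 * (M + 1)) * exp (- 2 * real n) < e"
      by (intro order_tendstoD)
    with ev show "\<forall>\<^sub>F n in sequentially. \<forall>x\<in>U. dist (shifted_logistic n (vs n x) - exp (vs n x)) 0 < e"
    proof eventually_elim
      case (elim n)
      show ?case
      proof
        fix x assume x: "x \<in> U"
        have "\<bar>shifted_logistic n (vs n x) - exp (vs n x)\<bar> \<le> exp (2 * vs n x) * exp (- 2 * real n)"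
          by (rule shifted_logistic_error)
        also have "\<dots> \<le> exp (2 * (M + 1)) * exp (- 2 * real n)"
          using elim(1) x by (intro mult_right_mono) (auto simp: abs_le_iff)
        finally show "dist (shifted_logistic n (vs n x) - exp (vs n x)) 0 < e"
          using elim(2) by simp
      qed
    qed
  qed
  ultimately have "uniform_limit U (\<lambda>n x. exp (vs n x) + (shifted_logistic n (vs n x) - exp (vs n x)))
      (\<lambda>x. exp (v x) + 0) sequentially"
    by (rule uniform_limit_add)
  then have "uniform_limit U (\<lambda>n x. shifted_logistic n (vs n x)) (\<lambda>x. exp (v x)) sequentially"
    by simp
  moreover have "bounded ((\<lambda>x. exp (v x)) ` U)"
    unfolding bounded_iff
  proof (intro exI[of _ "exp M"] ballI, elim imageE)
    fix y x assume "y = exp (v x)" "x \<in> U"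
    then show "norm y \<le> exp M"
      using abs_le_D1[OF M] by simp
  qed
  moreover have "continuous_on U (\<lambda>x. shifted_logistic n (vs n x))" for n
  proof (rule continuous_on_compose2[of UNIV "shifted_logistic n"])
    show "continuous_on UNIV (shifted_logistic n)"
      by (rule DERIV_continuous_on[OF DERIV_shifted_logistic])
    show "continuous_on U (vs n)"
      using assms by (simp add: C0_conv_def)
  qed simp
  moreover have "continuous_on U (\<lambda>x. exp (v x))"
    using assms by (auto simp: C0_conv_def intro!: continuous_intros)
  ultimately show ?thesis
    unfolding C0_conv_def by (intro conjI allI)
qed

lemma Ck_conv_shifted_logistic:
  "Ck_conv U k vs v \<Longrightarrow> Ck_conv U k (\<lambda>n x. shifted_logistic n (vs n x)) (\<lambda>x. exp (v x))"
proof (induction k arbitrary: vs v)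
  case 0
  then show ?case
    by (simp add: C0_conv_shifted_logistic)
next
  case (Suc k)
  show ?case
  proof (rule Ck_conv_SucI)
    show "C0_conv U (\<lambda>n x. shifted_logistic n (vs n x)) (\<lambda>x. exp (v x))"
      using Suc.prems by (intro C0_conv_shifted_logistic Ck_conv_0)
    fix i
    obtain vs' v' where v: "\<And>n. has_partial U i (vs n) (vs' n)" "has_partial U i v v'" "Ck_conv U k vs' v'"
      using Ck_conv_SucE[OF Suc.prems, of i] by blast
    let ?gs' = "\<lambda>n x. shifted_logistic n (vs n x) *
        (1 + - exp (- 2 * real n) * shifted_logistic n (vs n x)) * vs' n x"
    have IH: "Ck_conv U k (\<lambda>n x. shifted_logistic n (vs n x)) (\<lambda>x. exp (v x))"
      by (rule Suc.IH[OF Ck_conv_SucD[OF Suc.prems]])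
    have "(\<lambda>n. - exp (- 2 * real n)) \<longlonglongrightarrow> 0"
      by real_asymp
    \<comment> \<open>The limit keeps the factor \<open>1 + 0 * exp (v x)\<close>, the shape in
      which the rules for sums and products deliver it.\<close>
    then have "Ck_conv U k ?gs' (\<lambda>x. exp (v x) * (1 + 0 * exp (v x)) * v' x)"
      by (intro Ck_conv_mult Ck_conv_add Ck_conv_const IH v(3) tendsto_const)
    moreover have "has_partial U i (\<lambda>x. shifted_logistic n (vs n x)) (?gs' n)" for n
      by (rule has_partial_comp[OF v(1) DERIV_shifted_logistic])
    moreover have "has_partial U i (\<lambda>x. exp (v x)) (\<lambda>x. exp (v x) * (1 + 0 * exp (v x)) * v' x)"
      using has_partial_comp[OF v(2), of exp exp] by simp
    ultimately show "\<exists>gs' g'. (\<forall>n. has_partial U i (\<lambda>x. shifted_logistic n (vs n x)) (gs' n)) \<and>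
        has_partial U i (\<lambda>x. exp (v x)) g' \<and> Ck_conv U k gs' g'"
      by (intro exI[of _ ?gs'] exI[of _ "\<lambda>x. exp (v x) * (1 + 0 * exp (v x)) * v' x"] conjI allI)
  qed
qed

text \<open>\<open>\<phi> u\<close> is \<open>u\<close> up to an error that is small relative to
  \<open>u\<close>; on a bounded set the arguments \<open>x $ i / real (Suc n)\<close> tend to 0
  uniformly.\<close>

lemma C0_conv_rescaled_coord:
  fixes \<phi> :: "real \<Rightarrow> real" and U :: "(real^'d::finite) set"
  assumes "bounded U" "(\<phi> has_real_derivative 1) (at 0)" "\<phi> 0 = 0" "continuous_on UNIV \<phi>"
  shows "C0_conv U (\<lambda>n x. real (Suc n) * \<phi> (x $ i / real (Suc n))) (\<lambda>x. x $ i)"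
proof -
  obtain M where M: "M > 0" "\<And>x. x \<in> U \<Longrightarrow> \<bar>x $ i\<bar> \<le> M"
    using assms(1) component_le_norm_cart unfolding bounded_pos by (metis order_trans)
  have "uniform_limit U (\<lambda>n x. real (Suc n) * \<phi> (x $ i / real (Suc n))) (\<lambda>x. x $ i) sequentially"
  proof (rule uniform_limitI)
    fix e :: real assume e: "e > 0"
    have "(\<phi> has_derivative (\<lambda>h. h)) (at 0)"
      using assms(2) by (simp add: has_field_derivative_def mult_1[abs_def])
    then obtain d where d: "d > 0" "\<And>u. \<bar>u\<bar> < d \<Longrightarrow> \<bar>\<phi> u - u\<bar> \<le> e / (2 * M) * \<bar>u\<bar>"
      using e M(1) assms(3) unfolding has_derivative_at_alt
      by (metis (no_types, opaque_lifting) diff_zero divide_pos_pos mult_pos_pos real_norm_def zero_less_numeral)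
    have "(\<lambda>n. M / real (Suc n)) \<longlonglongrightarrow> 0"
      by real_asymp
    then have "\<forall>\<^sub>F n in sequentially. M / real (Suc n) < d"
      using d(1) by (intro order_tendstoD)
    then show "\<forall>\<^sub>F n in sequentially. \<forall>x\<in>U. dist (real (Suc n) * \<phi> (x $ i / real (Suc n))) (x $ i) < e"
    proof eventually_elim
      case (elim n)
      show ?case
      proof
        fix x assume x: "x \<in> U"
        define u where "u = x $ i / real (Suc n)"
        have xu: "x $ i = real (Suc n) * u"
          by (simp add: u_def)
        have "\<bar>u\<bar> \<le> M / real (Suc n)"
          using divide_right_mono[OF M(2)[OF x], of "real (Suc n)"] by (simp add: u_def)
        then have "\<bar>\<phi> u - u\<bar> \<le> e / (2 * M) * \<bar>u\<bar>"
          using elim by (intro d) linarith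
        then have "real (Suc n) * \<bar>\<phi> u - u\<bar> \<le> real (Suc n) * (e / (2 * M) * \<bar>u\<bar>)"
          by (rule mult_left_mono) simp
        also have "\<dots> = e / (2 * M) * \<bar>x $ i\<bar>"
          unfolding xu by (simp add: abs_mult)
        also have "\<dots> \<le> e / (2 * M) * M"
          using e M x by (intro mult_left_mono) auto
        also have "\<dots> < e"
          using e M by simp
        finally have "real (Suc n) * \<bar>\<phi> u - u\<bar> < e" .
        then have "dist (real (Suc n) * \<phi> u) (real (Suc n) * u) < e"
          by (simp only: dist_real_def right_diff_distrib[symmetric] abs_mult abs_of_nat)
        then show "dist (real (Suc n) * \<phi> (x $ i / real (Suc n))) (x $ i) < e"
          by (simp only: u_def[symmetric] xu[symmetric])
      qed
    qed
  qed
  moreover have "continuous_on U (\<lambda>x. real (Suc n) * \<phi> (x $ i / real (Suc n)))" for n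
    by (intro continuous_intros continuous_on_compose2[OF assms(4)]) auto
  moreover have "bounded ((\<lambda>x. x $ i) ` U)"
    using M(2) by (auto simp: bounded_iff)
  ultimately show ?thesis
    by (auto simp: C0_conv_def intro!: continuous_intros)
qed

text \<open>The differential equation covers \<open>tanh\<close> (\<open>a = 0\<close>, \<open>b = - 1\<close>) and \<open>exp - 1\<close> (\<open>a = 1\<close>, \<open>b = 0\<close>), and keeps
  the induction on the order of differentiation within the class of such functions.\<close>

lemma Ck_conv_rescaled_coord:
  fixes \<phi> :: "real \<Rightarrow> real" and U :: "(real^'d::finite) set"
  assumes "bounded U" "\<phi> 0 = 0"
    and D: "\<And>v. (\<phi> has_real_derivative 1 + a * \<phi> v + b * \<phi> v * \<phi> v) (at v)"
  shows "Ck_conv U k (\<lambda>n x. real (Suc n) * \<phi> (x $ i / real (Suc n))) (\<lambda>x. x $ i)"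
proof -
  have C0: "C0_conv U (\<lambda>n x. real (Suc n) * \<phi> (x $ i / real (Suc n))) (\<lambda>x. x $ i)"
  proof (rule C0_conv_rescaled_coord)
    show "(\<phi> has_real_derivative 1) (at 0)"
      using D[of 0] assms(2) by simp
    show "continuous_on UNIV \<phi>"
      by (rule DERIV_continuous_on[OF D])
  qed (use assms in auto)
  show ?thesis
  proof (induction k)
    case 0
    then show ?case
      using C0 by simp
  next
    case (Suc k)
    show ?case
    proof (rule Ck_conv_SucI[OF C0])
      fix j :: 'd
      define \<delta> :: real where "\<delta> = (if j = i then 1 else 0)"
      let ?X = "\<lambda>n x. real (Suc n) * \<phi> (x $ i / real (Suc n))"
      \<comment> \<open>Since \<open>\<phi>\<close> at the rescaled argument is
        \<open>?X n x / real (Suc n)\<close>, the differential equation expresses the derivative by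
        \<open>?X\<close> with coefficients tending to 0, and the induction hypothesis applies to
        \<open>?X\<close> itself.\<close>
      let ?gs' = "\<lambda>n x. \<delta> * (1 + a / real (Suc n) * ?X n x + b / (real (Suc n))\<^sup>2 * (?X n x * ?X n x))"
      have "(\<lambda>n. a / real (Suc n)) \<longlonglongrightarrow> 0"
        unfolding divide_inverse by (intro tendsto_mult_right_zero LIMSEQ_inverse_real_of_nat)
      moreover have "(\<lambda>n. b / (real (Suc n))\<^sup>2) \<longlonglongrightarrow> 0"
        unfolding divide_inverse power2_eq_square inverse_mult_distrib
        by (intro tendsto_mult_right_zero tendsto_mult_zero LIMSEQ_inverse_real_of_nat)
      ultimately have "Ck_conv U k ?gs' (\<lambda>x. \<delta> * (1 + 0 * x $ i + 0 * (x $ i * x $ i)))"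
        by (intro Ck_conv_mult Ck_conv_add Ck_conv_const Suc.IH tendsto_const)
      moreover have "has_partial U j (?X n) (?gs' n)" for n
      proof -
        have "((\<lambda>v. real (Suc n) * \<phi> (v / real (Suc n))) has_real_derivative
            1 + a * \<phi> (v / real (Suc n)) + b * \<phi> (v / real (Suc n)) * \<phi> (v / real (Suc n))) (at v)" for v
        proof -
          have "((\<lambda>v. v / real (Suc n)) has_real_derivative 1 / real (Suc n)) (at v)"
            by (auto intro!: derivative_eq_intros)
          from DERIV_cmult[OF DERIV_chain2[OF D this], of "real (Suc n)"] show ?thesis
            by simp
        qed
        note has_partial_comp[OF has_partial_coord[of U j i] this]
        also have "(\<lambda>x. (1 + a * \<phi> (x $ i / real (Suc n)) + b * \<phi> (x $ i / real (Suc n)) * \<phi> (x $ i / real (Suc n))) *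
            (if j = i then 1 else 0)) = ?gs' n"
        proof
          fix x :: "real^'d"
          have "real (Suc n) \<noteq> 0"
            by simp
          then show "(1 + a * \<phi> (x $ i / real (Suc n)) + b * \<phi> (x $ i / real (Suc n)) * \<phi> (x $ i / real (Suc n))) *
            (if j = i then 1 else 0) = ?gs' n x"
            unfolding \<delta>_def by (simp add: power2_eq_square del: of_nat_Suc)
        qed
        finally show ?thesis .
      qed
      moreover have "has_partial U j (\<lambda>x. x $ i) (\<lambda>x. \<delta> * (1 + 0 * x $ i + 0 * (x $ i * x $ i)))"
        using has_partial_coord[of U j i] by (simp add: \<delta>_def)
      ultimately show "\<exists>gs' g'. (\<forall>n. has_partial U j (?X n) (gs' n)) \<and>
          has_partial U j (\<lambda>x. x $ i) g' \<and> Ck_conv U k gs' g'"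
        by (intro exI[of _ ?gs'] exI[of _ "\<lambda>x. \<delta> * (1 + 0 * x $ i + 0 * (x $ i * x $ i))"] conjI allI)
    qed
  qed
qed

text \<open>The index set does not vary with \<open>n\<close>: limits are taken with a fixed number
  of terms.\<close>

lemma Ck_conv_sum:
  "finite I \<Longrightarrow> (\<And>q. q \<in> I \<Longrightarrow> Ck_conv U k (gs q) (g q)) \<Longrightarrow>
    Ck_conv U k (\<lambda>n x. \<Sum>q\<in>I. gs q n x) (\<lambda>x. \<Sum>q\<in>I. g q x)"
  by (induction I rule: finite_induct) (auto intro: Ck_conv_const Ck_conv_add)

section \<open>Polynomials as limits of exponential sums\<close>

text \<open>All frequencies lie on one grid with step \<open>t\<close>. Products stay on the grid,
  so the number of exponentials is at most \<open>(n + 1) ^ CARD('d)\<close> however many terms a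
  product produces; this count becomes the width of the second hidden layer.\<close>

definition exp_sum :: "nat \<Rightarrow> real \<Rightarrow> (real^'d::finite \<Rightarrow> real) \<Rightarrow> bool" where
  "exp_sum n t g \<longleftrightarrow> (\<exists>c. \<forall>x. g x =
     (\<Sum>q\<in>PiE UNIV (\<lambda>_. {..n}). c q * exp (t * (\<Sum>i\<in>UNIV. real (q i) * x $ i))))"

text \<open>Terms with the same frequency are collected by summing their coefficients over the
  fibres of \<open>Q\<close>.\<close>

lemma exp_sumI:
  assumes "finite I" "\<And>j i. j \<in> I \<Longrightarrow> Q j i \<le> n"
    and "\<And>x. g x = (\<Sum>j\<in>I. c j * exp (t * (\<Sum>i\<in>UNIV. real (Q j i) * x $ i)))"
  shows "exp_sum n t (g :: real^'d::finite \<Rightarrow> real)"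
proof -
  let ?P = "PiE UNIV (\<lambda>_::'d. {..n})"
  have "g x = (\<Sum>q\<in>?P. sum c {j \<in> I. Q j = q} * exp (t * (\<Sum>i\<in>UNIV. real (q i) * x $ i)))" for x
  proof -
    let ?h = "\<lambda>j. c j * exp (t * (\<Sum>i\<in>UNIV. real (Q j i) * x $ i))"
    have "(\<Sum>q\<in>?P. sum ?h {j \<in> I. Q j = q}) = sum ?h I"
    proof (rule sum.group)
      show "finite ?P"
        by (simp add: finite_PiE)
      show "Q ` I \<subseteq> ?P"
        using assms(2) by auto
    qed (rule assms(1))
    moreover have "sum ?h {j \<in> I. Q j = q} = sum c {j \<in> I. Q j = q} * exp (t * (\<Sum>i\<in>UNIV. real (q i) * x $ i))" for q
      by (simp add: sum_distrib_right)
    ultimately show ?thesis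
      by (simp add: assms(3))
  qed
  then show ?thesis
    unfolding exp_sum_def by (intro exI allI)
qed

lemma exp_sum_const: "exp_sum n t (\<lambda>_. a)"
  by (rule exp_sumI[of "{()}" "\<lambda>_ _. 0" _ _ "\<lambda>_. a"]) auto

lemma exp_sum_mono:
  assumes "exp_sum n t g" "n \<le> m"
  shows "exp_sum m t (g :: real^'d::finite \<Rightarrow> real)"
proof -
  obtain c where c: "\<And>x. g x = (\<Sum>q\<in>PiE UNIV (\<lambda>_. {..n}). c q * exp (t * (\<Sum>i\<in>UNIV. real (q i) * x $ i)))"
    using assms(1) unfolding exp_sum_def by blast
  show ?thesis
  proof (rule exp_sumI[OF _ _ c])
    show "finite (PiE UNIV (\<lambda>_::'d. {..n}))"
      by (simp add: finite_PiE)
    show "q i \<le> m" if "q \<in> PiE UNIV (\<lambda>_. {..n})" for q and i :: 'd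
      using PiE_mem[OF that, of i] assms(2) by simp
  qed
qed

lemma exp_sum_add:
  assumes "exp_sum n t g" "exp_sum n t h"
  shows "exp_sum n t (\<lambda>x. g x + h x :: real)"
proof -
  let ?e = "\<lambda>q x. exp (t * (\<Sum>i\<in>UNIV. real (q i) * x $ i))"
  obtain a where a: "\<And>x. g x = (\<Sum>q\<in>PiE UNIV (\<lambda>_. {..n}). a q * ?e q x)"
    using assms(1) unfolding exp_sum_def by blast
  obtain b where b: "\<And>x. h x = (\<Sum>q\<in>PiE UNIV (\<lambda>_. {..n}). b q * ?e q x)"
    using assms(2) unfolding exp_sum_def by blast
  show ?thesis
    unfolding exp_sum_def a b
    by (intro exI[of _ "\<lambda>q. a q + b q"]) (simp add: sum.distrib distrib_right)
qed

lemma exp_sum_mult: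
  fixes g h :: "real^'d::finite \<Rightarrow> real"
  assumes "exp_sum n t g" "exp_sum m t h"
  shows "exp_sum (n + m) t (\<lambda>x. g x * h x)"
proof -
  let ?e = "\<lambda>q x. exp (t * (\<Sum>i\<in>UNIV. real (q i) * x $ i))"
  obtain a where a: "\<And>x. g x = (\<Sum>q\<in>PiE UNIV (\<lambda>_. {..n}). a q * ?e q x)"
    using assms(1) unfolding exp_sum_def by blast
  obtain b where b: "\<And>x. h x = (\<Sum>q\<in>PiE UNIV (\<lambda>_. {..m}). b q * ?e q x)"
    using assms(2) unfolding exp_sum_def by blast
  have e_add: "?e q x * ?e r x = ?e (\<lambda>i. q i + r i) x" for q r x
  proof -
    have "(\<Sum>i\<in>UNIV. real (q i + r i) * x $ i) = (\<Sum>i\<in>UNIV. real (q i) * x $ i) + (\<Sum>i\<in>UNIV. real (r i) * x $ i)"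
      by (simp add: distrib_right sum.distrib)
    then show ?thesis
      by (simp only: distrib_left exp_add)
  qed
  have "a q * ?e q x * (b r * ?e r x) = (a q * b r) * ?e (\<lambda>i. q i + r i) x" for q r x
  proof -
    have "a q * ?e q x * (b r * ?e r x) = (a q * b r) * (?e q x * ?e r x)"
      by (simp only: mult_ac)
    then show ?thesis
      by (simp only: e_add)
  qed
  then have "g x * h x = (\<Sum>(q, r)\<in>PiE UNIV (\<lambda>_. {..n}) \<times> PiE UNIV (\<lambda>_. {..m}).
      (a q * b r) * ?e (\<lambda>i. q i + r i) x)" for x
    by (simp only: a b sum_product sum.cartesian_product)
  then show ?thesis
    by (intro exp_sumI[of "PiE UNIV (\<lambda>_. {..n}) \<times> PiE UNIV (\<lambda>_. {..m})" "\<lambda>(q, r) i. q i + r i" _ _ "\<lambda>(q, r). a q * b r"])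
       (auto simp: finite_PiE split_def intro!: add_mono dest: PiE_mem)
qed

lemma exp_sum_rescaled_coord:
  fixes i :: "'d::finite"
  shows "exp_sum 1 t (\<lambda>x. a * (exp (t * x $ i) - 1))"
proof (rule exp_sumI[of "{0, 1}" "\<lambda>j i'. if i' = i then j else 0" _ _ "\<lambda>j. if j = 0 then - a else a"])
  fix x :: "real^'d"
  have "(\<Sum>i'\<in>UNIV. real (if i' = i then j else 0) * x $ i') = real j * x $ i" for j
    by (subst sum.remove[of _ i]) auto
  then show "a * (exp (t * x $ i) - 1) = (\<Sum>j\<in>{0, 1}. (if j = 0 then - a else a) *
      exp (t * (\<Sum>i'\<in>UNIV. real (if i' = i then j else 0) * x $ i')))"
    by (simp add: algebra_simps)
qed auto

text \<open>The grid step \<open>1 / real (Suc m)\<close> depends on \<open>m\<close> only, not on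
  the polynomial; so the \<open>m\<close>-th approximants of two polynomials can be added and
  multiplied on a common grid.\<close>

lemma poly_deg_limit_of_exp_sums:
  fixes U :: "(real^'d::finite) set"
  assumes "bounded U" "poly_deg n p"
  shows "\<exists>P. (\<forall>m. exp_sum n (1 / real (Suc m)) (P m)) \<and> Ck_conv U k P p"
  using assms(2)
proof (induction rule: poly_deg.induct)
  case (const n c)
  show ?case
    by (intro exI[of _ "\<lambda>_ _. c"] conjI allI exp_sum_const Ck_conv_const tendsto_const)
next
  case (coord i)
  let ?P = "\<lambda>m x. real (Suc m) * (exp (x $ i / real (Suc m)) - 1)"
  have "exp_sum 1 (1 / real (Suc m)) (?P m)" for m
    using exp_sum_rescaled_coord[of "1 / real (Suc m)" "real (Suc m)" i] by simp
  moreover have "Ck_conv U k ?P (\<lambda>x. x $ i)"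
    by (rule Ck_conv_rescaled_coord[where \<phi> = "\<lambda>v. exp v - 1" and a = 1 and b = 0, OF assms(1)])
       (auto intro!: derivative_eq_intros)
  ultimately show ?case
    by (intro exI[of _ ?P] conjI allI)
next
  case (add n p q)
  then obtain P R where "\<forall>m. exp_sum n (1 / real (Suc m)) (P m)" "Ck_conv U k P p"
    "\<forall>m. exp_sum n (1 / real (Suc m)) (R m)" "Ck_conv U k R q"
    by blast
  then show ?case
    by (intro exI[of _ "\<lambda>m x. P m x + R m x"]) (auto intro: exp_sum_add Ck_conv_add)
next
  case (mult n p m q)
  then obtain P R where "\<forall>j. exp_sum n (1 / real (Suc j)) (P j)" "Ck_conv U k P p"
    "\<forall>j. exp_sum m (1 / real (Suc j)) (R j)" "Ck_conv U k R q"
    by blast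
  then show ?case
    by (intro exI[of _ "\<lambda>j x. P j x * R j x"]) (auto intro: exp_sum_mult Ck_conv_mult)
next
  case (mono n p m)
  then show ?case
    using exp_sum_mono by blast
qed

section \<open>Approximation of polynomials by networks of fixed size\<close>

lemma affine_mapI: "affine_map m n (\<lambda>x i. if i < n then (\<Sum>j<m. W i j * x j) + b i else 0)"
  by (auto simp: affine_map_def)

text \<open>The first hidden layer rescales each coordinate separately by \<open>u\<close>, and the
  second has one neuron for each element of \<open>I\<close>.\<close>

lemma two_hidden_layer_network:
  fixes w :: "'q \<Rightarrow> 'd::finite \<Rightarrow> real"
  assumes "finite I" "I \<noteq> {}"
  shows "\<exists>F. tanh_network [CARD('d), CARD('d), card I, 1] F \<and>
    (\<forall>x :: real^'d. realize F x = (\<Sum>q\<in>I. c q * tanh ((\<Sum>i\<in>UNIV. w q i * tanh (u * x $ i)) + b q)) + c0)"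
proof -
  let ?d = "CARD('d)"
  let ?\<pi> = "from_nat_into (UNIV :: 'd set)"
  have \<pi>: "bij_betw ?\<pi> {..<?d} UNIV"
    using bij_betw_from_nat_into_finite[of "UNIV :: 'd set"] by simp
  \<comment> \<open>Neurons are indexed by natural numbers, so \<open>I\<close> has to be
    numbered.\<close>
  obtain e where e: "bij_betw e {..<card I} I"
    using ex_bij_betw_nat_finite[OF assms(1)] by (auto simp: atLeast0LessThan)
  define A1 where "A1 x i = (if i < ?d then (\<Sum>j<?d. (if i = j then u else 0) * x j) + 0 else 0)" for x i
  define A2 where "A2 x i = (if i < card I then (\<Sum>j<?d. w (e i) (?\<pi> j) * x j) + b (e i) else 0)" for x i
  define A3 where "A3 x i = (if i < 1 then (\<Sum>j<card I. c (e j) * x j) + c0 else 0)" for x and i :: nat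
  define A where "A k = (if k = 1 then A1 else if k = 2 then A2 else A3)" for k :: nat
  define F where "F = tanh_compose A 2"
  \<comment> \<open>All layer widths have to be positive, which is why \<open>I\<close> is
    nonempty.\<close>
  have cI: "card I > 0"
    using assms by (simp add: card_gt_0_iff)
  have "affine_map ?d ?d A1" "affine_map ?d (card I) A2" "affine_map (card I) 1 A3"
    unfolding A1_def[abs_def] A2_def[abs_def] A3_def[abs_def] by (rule affine_mapI)+
  moreover have "{1..<4::nat} = {1, 2, 3}"
    by auto
  ultimately have "\<forall>k\<in>{1..<4}. affine_map ([?d, ?d, card I, 1] ! (k - 1)) ([?d, ?d, card I, 1] ! k) (A k)"
    by (simp add: A_def)
  then have "tanh_network [?d, ?d, card I, 1] F"
    unfolding tanh_network_def F_def using cI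
    by (auto intro!: exI[of _ A] simp: numeral_2_eq_2 simp del: tanh_compose.simps)
  moreover have "realize F x = (\<Sum>q\<in>I. c q * tanh ((\<Sum>i\<in>UNIV. w q i * tanh (u * x $ i)) + b q)) + c0" for x :: "real^'d"
  proof -
    have 1: "A1 (coords x) j = u * x $ ?\<pi> j" if "j < ?d" for j
      using that by (simp add: A1_def coords_def if_distrib[of "\<lambda>y. y * _"] cong: if_cong)
    have "(\<Sum>j<?d. w (e i) (?\<pi> j) * tanh (A1 (coords x) j)) = (\<Sum>i'\<in>UNIV. w (e i) i' * tanh (u * x $ i'))" for i
      using sum.reindex_bij_betw[OF \<pi>, of "\<lambda>i'. w (e i) i' * tanh (u * x $ i')"] by (simp add: 1)
    then have 2: "A2 (\<lambda>i. tanh (A1 (coords x) i)) j = (\<Sum>i\<in>UNIV. w (e j) i * tanh (u * x $ i)) + b (e j)" if "j < card I" for j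
      using that by (simp add: A2_def)
    have "realize F x = A3 (\<lambda>i. tanh (A2 (\<lambda>i. tanh (A1 (coords x) i)) i)) 0"
      by (simp add: realize_def F_def A_def numeral_2_eq_2 o_def)
    also have "\<dots> = (\<Sum>j<card I. c (e j) * tanh ((\<Sum>i\<in>UNIV. w (e j) i * tanh (u * x $ i)) + b (e j))) + c0"
      by (simp add: A3_def 2)
    finally show ?thesis
      using sum.reindex_bij_betw[OF e, of "\<lambda>q. c q * tanh ((\<Sum>i\<in>UNIV. w q i * tanh (u * x $ i)) + b q)"] by simp
  qed
  ultimately show ?thesis
    by (intro exI[of _ F] conjI allI)
qed

text \<open>The inner limit \<open>X m i\<close> towards the coordinate and the outer limit towards
  \<open>exp\<close> share the parameter \<open>m\<close>: \<open>Ck_conv_shifted_logistic\<close>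
  admits arguments that vary with \<open>m\<close>, and only the weights depend on
  \<open>m\<close>.\<close>

lemma exp_sum_network:
  fixes U :: "(real^'d::finite) set"
  assumes "bounded U" "exp_sum n t g"
  obtains F where "\<And>m. tanh_network [CARD('d), CARD('d), (n + 1) ^ CARD('d), 1] (F m)"
    "Ck_conv U k (\<lambda>m. realize (F m)) g"
proof -
  let ?I = "PiE UNIV (\<lambda>_::'d. {..n})"
  obtain c where c: "\<And>x. g x = (\<Sum>q\<in>?I. c q * exp (t * (\<Sum>i\<in>UNIV. real (q i) * x $ i)))"
    using assms(2) unfolding exp_sum_def by blast
  define X where "X m i x = real (Suc m) * tanh (x $ i / real (Suc m))" for m i and x :: "real^'d"
  define S where "S m x = (\<Sum>q\<in>?I. c q * shifted_logistic m (t * (\<Sum>i\<in>UNIV. real (q i) * X m i x)))" for m and x :: "real^'d"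
  have fin: "finite ?I" "?I \<noteq> {}"
    by (auto simp: finite_PiE PiE_eq_empty_iff)
  have card: "card ?I = (n + 1) ^ CARD('d)"
    by (simp add: card_PiE)
  have "\<exists>F. tanh_network [CARD('d), CARD('d), (n + 1) ^ CARD('d), 1] F \<and> realize F = S m" for m
  proof -
    \<comment> \<open>The outer factor of \<open>shifted_logistic\<close>. Its constant part, summed
      over all terms, goes into the bias of the output layer.\<close>
    define C where "C = exp (2 * real m) / 2"
    \<comment> \<open>The half stems from the argument \<open>v / 2\<close> of \<open>tanh\<close>,
      and \<open>real (Suc m)\<close> undoes the scaling of the first layer.\<close>
    let ?w = "\<lambda>q i. t / 2 * real (q i) * real (Suc m)"
    have "\<exists>F. tanh_network [CARD('d), CARD('d), (n + 1) ^ CARD('d), 1] F \<and> (\<forall>x :: real^'d. realize F x =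
        (\<Sum>q\<in>?I. c q * C * tanh ((\<Sum>i\<in>UNIV. ?w q i * tanh (1 / real (Suc m) * x $ i)) + - real m)) +
        (\<Sum>q\<in>?I. c q * C))"
      unfolding card[symmetric] by (rule two_hidden_layer_network[OF fin])
    then obtain F where F: "tanh_network [CARD('d), CARD('d), (n + 1) ^ CARD('d), 1] F"
      "\<forall>x :: real^'d. realize F x =
        (\<Sum>q\<in>?I. c q * C * tanh ((\<Sum>i\<in>UNIV. ?w q i * tanh (1 / real (Suc m) * x $ i)) + - real m)) +
        (\<Sum>q\<in>?I. c q * C)"
      by (elim exE conjE)
    have "realize F x = S m x" for x
    proof -
      let ?v = "\<lambda>q. t * (\<Sum>i\<in>UNIV. real (q i) * X m i x)"
      have arg: "(\<Sum>i\<in>UNIV. t / 2 * real (q i) * real (Suc m) * tanh (1 / real (Suc m) * x $ i)) + - real m =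
          ?v q / 2 - real m" for q
      proof -
        have "(\<Sum>i\<in>UNIV. t / 2 * real (q i) * real (Suc m) * tanh (1 / real (Suc m) * x $ i)) =
            (\<Sum>i\<in>UNIV. t / 2 * (real (q i) * X m i x))"
          by (intro sum.cong refl) (simp only: X_def mult.assoc mult_1 times_divide_eq_left)
        also have "\<dots> = t / 2 * (\<Sum>i\<in>UNIV. real (q i) * X m i x)"
          by (rule sum_distrib_left[symmetric])
        finally show ?thesis
          by simp
      qed
      have "realize F x = (\<Sum>q\<in>?I. c q * C * tanh (?v q / 2 - real m)) + (\<Sum>q\<in>?I. c q * C)"
        unfolding F(2)[rule_format] arg by (rule refl)
      also have "\<dots> = (\<Sum>q\<in>?I. c q * C * tanh (?v q / 2 - real m) + c q * C)"
        by (rule sum.distrib[symmetric])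
      also have "\<dots> = S m x"
        unfolding S_def shifted_logistic_def C_def by (intro sum.cong refl) (simp add: field_simps)
      finally show ?thesis .
    qed
    then have "realize F = S m"
      by (rule ext)
    with F(1) show ?thesis
      by (intro exI[of _ F] conjI)
  qed
  then have "\<exists>F. \<forall>m. tanh_network [CARD('d), CARD('d), (n + 1) ^ CARD('d), 1] (F m) \<and> realize (F m) = S m"
    by (intro choice allI)
  then obtain F where "\<forall>m. tanh_network [CARD('d), CARD('d), (n + 1) ^ CARD('d), 1] (F m) \<and> realize (F m) = S m"
    by (rule exE)
  then have F: "\<And>m. tanh_network [CARD('d), CARD('d), (n + 1) ^ CARD('d), 1] (F m)" "\<And>m. realize (F m) = S m"
    by simp_all
  have "Ck_conv U k (\<lambda>m. X m i) (\<lambda>x. x $ i)" for i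
    unfolding X_def
    by (rule Ck_conv_rescaled_coord[where a = 0 and b = "-1", OF assms(1)])
       (auto intro!: derivative_eq_intros simp: power2_eq_square)
  then have "Ck_conv U k S (\<lambda>x. \<Sum>q\<in>?I. c q * exp (t * (\<Sum>i\<in>UNIV. real (q i) * x $ i)))"
    unfolding S_def
    by (intro Ck_conv_sum fin Ck_conv_mult Ck_conv_shifted_logistic Ck_conv_const tendsto_const) auto
  then have "Ck_conv U k S g"
    by (simp only: c[symmetric])
  then show thesis
    using F(1) by (intro that[of F]) (simp_all only: F(2))
qed

text \<open>The limit statements control approximation minus target, the theorem asks for target
  minus approximation.\<close>

lemma Ck_le_uminus: "Ck_le U k e g \<Longrightarrow> Ck_le U k e (\<lambda>x. - g x)"
proof (induction k arbitrary: g)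
  case 0
  then show ?case
    by (auto simp: C0_le_def intro: continuous_intros)
next
  case (Suc k)
  have "\<exists>f. has_partial U i (\<lambda>x. - g x) f \<and> Ck_le U k e f" for i
  proof -
    obtain g' where "has_partial U i g g'" "Ck_le U k e g'"
      using Suc.prems by auto
    with has_partial_diff[OF has_partial_const[of U i 0], of g g'] Suc.IH[of g'] show ?thesis
      by auto
  qed
  moreover have "C0_le U e (\<lambda>x. - g x)"
    using Ck_le_0[OF Suc.prems] by (auto simp: C0_le_def intro: continuous_intros)
  ultimately show ?case
    by simp
qed

text \<open>Two successive limits with half of the error each: the exponential sum is fixed before
  the networks converging to it are chosen.\<close>

lemma poly_deg_network:
  fixes U :: "(real^'d::finite) set"
  assumes "bounded U" "poly_deg n p" "e > 0"
  obtains F where "tanh_network [CARD('d), CARD('d), (n + 1) ^ CARD('d), 1] F"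
    "Ck_le U k e (\<lambda>x. p x - realize F x)"
proof -
  obtain P where P: "\<And>m. exp_sum n (1 / real (Suc m)) (P m)" "Ck_conv U k P p"
    using poly_deg_limit_of_exp_sums[OF assms(1,2)] by blast
  obtain m where m: "Ck_le U k (e / 2) (\<lambda>x. P m x - p x)"
    using Ck_conv_imp_Ck_le[OF P(2), of "e / 2"] assms(3) by (auto simp: eventually_sequentially)
  obtain F where F: "\<And>j. tanh_network [CARD('d), CARD('d), (n + 1) ^ CARD('d), 1] (F j)"
    "Ck_conv U k (\<lambda>j. realize (F j)) (P m)"
    using exp_sum_network[OF assms(1) P(1)] by blast
  obtain j where j: "Ck_le U k (e / 2) (\<lambda>x. realize (F j) x - P m x)"
    using Ck_conv_imp_Ck_le[OF F(2), of "e / 2"] assms(3) by (auto simp: eventually_sequentially)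
  have "Ck_le U k e (\<lambda>x. p x - realize (F j) x)"
    using Ck_le_uminus[OF Ck_le_add[OF m j]] by simp
  with F(1) show thesis
    by (rule that)
qed

text \<open>Markov's inequality is applied along the axes, so the neighbourhood is wanted in the
  shape of a box. A point of the box is close to the point of the cube obtained by clamping its
  coordinates.\<close>

lemma unit_cube_neighbourhood:
  fixes \<Omega> :: "(real^'d::finite) set"
  assumes "open \<Omega>" "unit_cube \<subseteq> \<Omega>"
  obtains \<eta> where "\<eta> > 0" "cbox (\<chi> i. - \<eta>) (\<chi> i. 1 + \<eta>) \<subseteq> \<Omega>"
proof -
  obtain e where e: "e > 0" "(\<Union>x\<in>unit_cube. ball x e) \<subseteq> \<Omega>"
    using compact_subset_open_imp_ball_epsilon_subset[OF compact_cbox assms(1,2)] by blast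
  define \<eta> where "\<eta> = e / (2 * real CARD('d))"
  have \<eta>: "\<eta> > 0"
    using e(1) by (simp add: \<eta>_def)
  have "y \<in> \<Omega>" if y: "y \<in> cbox (\<chi> i. - \<eta>) (\<chi> i. 1 + \<eta>)" for y
  proof -
    define x :: "real^'d" where "x = (\<chi> i. max 0 (min 1 (y $ i)))"
    have "x \<in> unit_cube"
      by (simp add: x_def mem_box_cart)
    moreover have "norm (x - y) \<le> (\<Sum>i\<in>UNIV. \<bar>(x - y) $ i\<bar>)"
      by (rule norm_le_l1_cart)
    moreover have "\<dots> \<le> (\<Sum>i\<in>(UNIV::'d set). \<eta>)"
    proof (intro sum_mono)
      fix i
      have "- \<eta> \<le> y $ i" "y $ i \<le> 1 + \<eta>"
        using y by (auto simp: mem_box_cart)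
      then show "\<bar>(x - y) $ i\<bar> \<le> \<eta>"
        using \<eta> by (simp add: x_def)
    qed
    moreover have "\<dots> = e / 2"
      by (simp add: \<eta>_def)
    ultimately have "x \<in> unit_cube" "y \<in> ball x e"
      using e(1) by (auto simp: dist_norm)
    then show ?thesis
      using e(2) by blast
  qed
  with \<eta> show thesis
    by (intro that) auto
qed

text \<open>The compact box \<open>?Q\<close> carries the polynomial approximation, the open cube
  \<open>U\<close> inside it the derivatives. The polynomial \<open>G s\<close> is realized up to
  \<open>\<rho> ^ s\<close>, which only raises the constant by 1.\<close>

lemma network_rate:
  fixes f :: "real^'d::finite \<Rightarrow> real"
  assumes "real_analytic_on f \<Omega>" "open \<Omega>" "unit_cube \<subseteq> \<Omega>"
  shows "\<exists>A C \<rho>. 0 < \<rho> \<and> \<rho> < 1 \<and>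
    (\<forall>s. \<exists>F. tanh_network [CARD('d), CARD('d), (A * (s + 1) + 1) ^ CARD('d), 1] F \<and>
       sobolev_norm k unit_cube (\<lambda>x. f x - realize F x) \<le> ereal (C * \<rho> ^ s))"
proof -
  obtain \<eta> where \<eta>: "\<eta> > 0" "cbox (\<chi> i. - \<eta>) (\<chi> i. 1 + \<eta>) \<subseteq> \<Omega>"
    using unit_cube_neighbourhood[OF assms(2,3)] by blast
  let ?Q = "cbox (\<chi> i. - \<eta>) (\<chi> i. 1 + \<eta>) :: (real^'d) set"
  define U :: "(real^'d) set" where "U = {x. \<forall>i. - \<eta> < x $ i \<and> x $ i < 1 + \<eta>}"
  have UQ: "U \<subseteq> ?Q"
    by (auto simp: U_def mem_box_cart less_imp_le)
  have U: "open U" "bounded U" "unit_cube \<subseteq> U"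
  proof -
    show "open U"
      unfolding U_def by (rule open_cube)
    show "bounded U"
      using UQ bounded_cbox bounded_subset by blast
    show "unit_cube \<subseteq> U"
    proof
      fix x :: "real^'d" assume x: "x \<in> unit_cube"
      have "- \<eta> < x $ i \<and> x $ i < 1 + \<eta>" for i
      proof -
        have "0 \<le> x $ i" "x $ i \<le> 1"
          using x by (auto simp: mem_box_cart)
        then show ?thesis
          using \<eta>(1) by auto
      qed
      then show "x \<in> U"
        by (simp add: U_def)
    qed
  qed
  have "exp_approx ?Q f ?Q"
    using assms(1) compact_cbox \<eta>(2) by (rule exp_approx_real_analytic)
  then obtain C K A where A: "\<And>s. \<exists>p. poly_deg (A * (s + 1)) p \<and>
     (\<forall>x\<in>?Q. \<bar>f x - p x\<bar> \<le> C / 2 ^ s) \<and> (\<forall>x\<in>?Q. \<bar>p x\<bar> \<le> C * K ^ s)"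
    unfolding exp_approx_def by blast
  have "\<exists>G. \<forall>s. poly_deg (A * (s + 1)) (G s) \<and> (\<forall>x\<in>?Q. \<bar>f x - G s x\<bar> \<le> C / 2 ^ s)"
    using A by (intro choice allI) blast
  then obtain G where G: "\<And>s. poly_deg (A * (s + 1)) (G s)" "\<And>s. \<forall>x\<in>?Q. \<bar>f x - G s x\<bar> \<le> C / 2 ^ s"
    by blast
  have "\<bar>f x - G s x\<bar> \<le> C * (1 / 2) ^ s" if "x \<in> U" for x s
    using G(2)[of s] subsetD[OF UQ that] by (simp add: power_one_over)
  then obtain C' \<rho> where \<rho>: "0 < \<rho>" "\<rho> < 1" "\<And>s. Ck_le U k (C' * \<rho> ^ s) (\<lambda>x. f x - G s x)"
    using Ck_le_geometric[OF U_def _ G(1), of "1 / 2" f C k] \<eta>(1) by auto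
  have "\<exists>F. tanh_network [CARD('d), CARD('d), (A * (s + 1) + 1) ^ CARD('d), 1] F \<and>
       sobolev_norm k unit_cube (\<lambda>x. f x - realize F x) \<le> ereal ((C' + 1) * \<rho> ^ s)" for s
  proof -
    obtain F where F: "tanh_network [CARD('d), CARD('d), (A * (s + 1) + 1) ^ CARD('d), 1] F"
      "Ck_le U k (\<rho> ^ s) (\<lambda>x. G s x - realize F x)"
      using poly_deg_network[OF U(2) G(1), of "\<rho> ^ s" s k] \<rho>(1) by auto
    have "Ck_le U k ((C' + 1) * \<rho> ^ s) (\<lambda>x. f x - realize F x)"
      using Ck_le_add[OF \<rho>(3)[of s] F(2)] by (simp add: distrib_right)
    from F(1) sobolev_norm_le[OF U(1) this U(3)] show ?thesis
      by blast
  qed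
  with \<rho>(1,2) show ?thesis
    by (intro exI[of _ A] exI[of _ "C' + 1"] exI[of _ \<rho>] conjI allI)
qed

section \<open>Choice of the width and conclusion\<close>

lemma mixed_deriv_0: "mixed_deriv (\<lambda>_. 0) f = f"
proof -
  have "fold (\<lambda>j. partial_deriv (\<pi> j) ^^ 0) js f = f" for \<pi> :: "nat \<Rightarrow> 'a" and js
    by (induction js) auto
  then show ?thesis
    unfolding mixed_deriv_def .
qed

lemma sobolev_seminorm_0: "sobolev_seminorm 0 S f = Linf_norm S f"
proof -
  have "{\<beta>::'a \<Rightarrow> nat. (\<Sum>i\<in>UNIV. \<beta> i) = 0} = {\<lambda>_. 0}"
    by auto
  then show ?thesis
    unfolding sobolev_seminorm_def by (simp only:) (simp add: mixed_deriv_0)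
qed

lemma sobolev_norm_0: "sobolev_norm 0 S f = Linf_norm S f"
  by (simp add: sobolev_norm_def sobolev_seminorm_0)

lemma eventually_geometric_root_le:
  fixes \<rho> :: real
  assumes "0 < \<rho>" "\<rho> < 1" "\<mu> > 0" "d > 0"
  shows "\<forall>\<^sub>F N in sequentially. C * \<rho> ^ nat \<lceil>real N powr (1 / real d)\<rceil>
    \<le> \<mu> * exp (- \<alpha> * real N powr (1 / (real d + 1)) * ln (real N))"
proof -
  define a b where "a = 1 / real d" and "b = 1 / (real d + 1)"
  have ab: "0 < b" "b < a"
    using assms(4) by (simp_all add: a_def b_def divide_strict_left_mono)
  define L where "L = - ln \<rho>"
  have L: "L > 0"
    using assms by (simp add: L_def)
  \<comment> \<open>After taking logarithms, the claim is
    \<open>\<alpha> * N powr b * ln N + K \<le> L * N powr a\<close> with \<open>b < a\<close>. The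
    summand 1 in \<open>\<bar>C\<bar> + 1\<close> keeps the logarithm meaningful.\<close>
  define K where "K = ln (\<bar>C\<bar> + 1) - ln \<mu>"
  have "((\<lambda>N::nat. (\<alpha> * real N powr b * ln (real N) + K) / real N powr a) \<longlongrightarrow> 0) sequentially"
    using ab by real_asymp
  then have "\<forall>\<^sub>F N in sequentially. (\<alpha> * real N powr b * ln (real N) + K) / real N powr a < L"
    using L by (intro order_tendstoD)
  with eventually_gt_at_top[of 0] show ?thesis
  proof eventually_elim
    case (elim N)
    define x where "x = real N powr a"
    have "x > 0"
      using elim by (simp add: x_def)
    then have main: "K - L * x \<le> - \<alpha> * real N powr b * ln (real N)"
      using elim(2) by (simp add: x_def[symmetric] divide_simps)
    have "C * \<rho> ^ nat \<lceil>x\<rceil> \<le> (\<bar>C\<bar> + 1) * \<rho> powr x"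
    proof (intro mult_mono)
      have "\<rho> ^ nat \<lceil>x\<rceil> = \<rho> powr real (nat \<lceil>x\<rceil>)"
        using assms(1) by (simp add: powr_realpow)
      also have "\<dots> \<le> \<rho> powr x"
        using assms(1,2) by (intro powr_mono') (auto simp: real_nat_ceiling_ge)
      finally show "\<rho> ^ nat \<lceil>x\<rceil> \<le> \<rho> powr x" .
    qed (use assms in auto)
    also have "\<dots> = exp (ln (\<bar>C\<bar> + 1)) * exp (- (L * x))"
      using assms(1) by (simp add: powr_def L_def mult.commute)
    also have "\<dots> = \<mu> * exp (K - L * x)"
      using assms(3) by (simp add: K_def exp_diff exp_minus divide_inverse)
    also have "\<dots> \<le> \<mu> * exp (- \<alpha> * real N powr b * ln (real N))"
      using main assms(3) by (intro mult_left_mono) auto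
    finally show ?case
      unfolding x_def a_def b_def .
  qed
qed

text \<open>For large \<open>N\<close> the degree parameter \<open>r N\<close>, the rounded
  \<open>d\<close>-th root of \<open>N\<close>, reaches the target, and the \<open>d\<close>-th
  power of a linear function of it is linear in \<open>N\<close>. All other \<open>N\<close> receive
  some sufficient \<open>s0 N\<close>; being finitely many, they do not affect the growth of
  \<open>w\<close>.\<close>

lemma linear_width:
  fixes \<rho> :: real
  assumes \<rho>: "0 < \<rho>" "\<rho> < 1" and "\<mu> > 0" "d > 0"
  shows "\<exists>w. (\<lambda>N. real (w N)) \<in> O(\<lambda>N. real N) \<and>
    (\<forall>N. d \<le> w N \<and> (\<exists>s. C * \<rho> ^ s \<le> \<mu> * exp (- \<alpha> * real N powr (1 / (real d + 1)) * ln (real N)) \<and>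
       (A * (s + 1) + 1) ^ d \<le> w N))"
proof -
  define target where "target N = \<mu> * exp (- \<alpha> * real N powr (1 / (real d + 1)) * ln (real N))" for N
  have target: "target N > 0" for N
    using assms(3) by (simp add: target_def)
  define r where "r N = nat \<lceil>real N powr (1 / real d)\<rceil>" for N
  have "\<exists>s. C * \<rho> ^ s \<le> target N" for N
  proof -
    have "(\<lambda>s. C * \<rho> ^ s) \<longlonglongrightarrow> 0"
      using \<rho> by (intro tendsto_mult_right_zero LIMSEQ_power_zero) auto
    then have "\<forall>\<^sub>F s in sequentially. C * \<rho> ^ s < target N"
      using target by (intro order_tendstoD)
    then obtain s where "C * \<rho> ^ s < target N"
      using eventually_happens by fastforce
    then show ?thesis
      using less_imp_le by blast
  qed
  then obtain s0 where s0: "\<And>N. C * \<rho> ^ s0 N \<le> target N"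
    by metis
  define s where "s N = (if C * \<rho> ^ r N \<le> target N then r N else s0 N)" for N
  have s: "C * \<rho> ^ s N \<le> target N" for N
    using s0 by (simp add: s_def)
  \<comment> \<open>The summand \<open>d\<close> makes room for the first hidden layer.\<close>
  define w where "w N = d + (A * (s N + 1) + 1) ^ d" for N
  have "\<forall>\<^sub>F N in sequentially. C * \<rho> ^ r N \<le> target N"
    unfolding r_def target_def by (rule eventually_geometric_root_le[OF assms])
  with eventually_ge_at_top[of 1]
  have "\<forall>\<^sub>F N in sequentially. norm (real (w N)) \<le> (real d + (3 * real A + 1) ^ d) * norm (real N)"
  proof eventually_elim
    case (elim N)
    define x where "x = real N powr (1 / real d)"
    have x1: "x \<ge> 1"
      using elim(1) by (simp add: x_def ge_one_powr_ge_zero)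
    have "real (r N) \<le> x + 1"
      using x1 by (simp add: r_def x_def[symmetric])
    have "real (A * (s N + 1) + 1) = real A * (real (r N) + 1) + 1"
      using elim(2) by (simp add: s_def algebra_simps)
    also have "\<dots> \<le> real A * (x + 2) + 1"
      using \<open>real (r N) \<le> x + 1\<close> by (intro add_right_mono mult_left_mono) auto
    also have "\<dots> \<le> real A * (3 * x) + x"
      using x1 by (intro add_mono mult_left_mono) auto
    also have "\<dots> = (3 * real A + 1) * x"
      by (simp add: algebra_simps)
    finally have "real (A * (s N + 1) + 1) ^ d \<le> ((3 * real A + 1) * x) ^ d"
      by (intro power_mono) auto
    also have "x ^ d = real N"
      using elim(1) assms(4) by (simp add: x_def powr_realpow[symmetric] powr_powr)
    then have "((3 * real A + 1) * x) ^ d = (3 * real A + 1) ^ d * real N"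
      by (simp add: power_mult_distrib)
    finally have "real ((A * (s N + 1) + 1) ^ d) \<le> (3 * real A + 1) ^ d * real N"
      by (simp only: of_nat_power)
    moreover have "real d * 1 \<le> real d * real N"
      using elim(1) by (intro mult_left_mono) auto
    ultimately show ?case
      unfolding w_def by (simp only: of_nat_add distrib_right) simp
  qed
  then have "(\<lambda>N. real (w N)) \<in> O(\<lambda>N. real N)"
    by (rule bigoI)
  moreover have "d \<le> w N" for N
    by (simp add: w_def)
  moreover have "\<exists>s. C * \<rho> ^ s \<le> \<mu> * exp (- \<alpha> * real N powr (1 / (real d + 1)) * ln (real N)) \<and>
      (A * (s + 1) + 1) ^ d \<le> w N" for N
    using s[of N] by (intro exI[of _ "s N"]) (simp add: w_def target_def)
  ultimately show ?thesis
    by (intro exI[of _ w] conjI allI)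
qed

lemma exp_root_log_le:
  assumes "\<alpha> > 0" "N \<ge> (1::nat)"
  shows "exp (- \<alpha> * real N powr (1 / (real d + 1)) * ln (real N)) \<le> real N powr (- \<alpha>)"
proof -
  have "1 \<le> real N powr (1 / (real d + 1))"
    using assms by (intro ge_one_powr_ge_zero) auto
  then have "\<alpha> * ln (real N) * 1 \<le> \<alpha> * ln (real N) * real N powr (1 / (real d + 1))"
    using assms by (intro mult_left_mono) auto
  then show ?thesis
    using assms by (simp add: powr_def mult_ac)
qed

lemma zero_network:
  obtains F where "tanh_network [CARD('d::finite), CARD('d), 1, 1] F" "\<And>x :: real^'d. realize F x = 0"
  using two_hidden_layer_network[of "{()}" "\<lambda>_. 0" "\<lambda>_ _. 0" 0 "\<lambda>_. 0" 0] by auto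

theorem corollary5p6:
  fixes k :: nat and \<alpha> :: real
    and \<Omega> :: "(real^'d::finite) set" and f :: "real^'d \<Rightarrow> real"
  assumes "\<alpha> > 0" and "open \<Omega>" and "unit_cube \<subseteq> \<Omega>"
  shows "\<exists>c>0. \<exists>w :: nat \<Rightarrow> nat. (\<lambda>N. real (w N)) \<in> O(\<lambda>N. real N) \<and>
    (\<forall>\<delta>>0. \<forall>Q>0. \<forall>R>0. QR_analytic Q R \<Omega> f \<longrightarrow>
      (\<forall>N\<ge>1. \<exists>l\<^sub>1 l\<^sub>2 F.
        tanh_network [CARD('d), l\<^sub>1, l\<^sub>2, 1] F \<and> l\<^sub>1 \<le> w N \<and> l\<^sub>2 \<le> w N \<and>
        sobolev_norm k unit_cube (\<lambda>x. f x - realize F x)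
          \<le> ereal (c * real N powr (real k / (real CARD('d) + 1))
                   * exp (- \<alpha> * real N powr (1 / (real CARD('d) + 1)) * ln (real N))) \<and>
        c * real N powr (real k / (real CARD('d) + 1))
            * exp (- \<alpha> * real N powr (1 / (real CARD('d) + 1)) * ln (real N))
          \<le> c / real N powr (\<alpha> - real k / (real CARD('d) + 1)) \<and>
        (k = 0 \<longrightarrow>
          Linf_norm unit_cube (\<lambda>x. f x - realize F x)
            \<le> ereal ((1 + \<delta>) * Q * exp (- \<alpha> * real N powr (1 / (real CARD('d) + 1)) * ln (real N))) \<and>
          (1 + \<delta>) * Q * exp (- \<alpha> * real N powr (1 / (real CARD('d) + 1)) * ln (real N))
            \<le> (1 + \<delta>) * Q / real N powr \<alpha>)))"
proof -
  let ?d = "real CARD('d)"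
  let ?E = "\<lambda>N. exp (- \<alpha> * real N powr (1 / (?d + 1)) * ln (real N))"
  have sob: "c * real N powr (real k / (?d + 1)) * ?E N \<le> c / real N powr (\<alpha> - real k / (?d + 1))"
    if "c > 0" "N \<ge> 1" for c N
  proof -
    have "c * real N powr (real k / (?d + 1)) * ?E N \<le> c * real N powr (real k / (?d + 1)) * real N powr (- \<alpha>)"
      using that assms(1) by (intro mult_left_mono exp_root_log_le) auto
    also have "\<dots> = c * real N powr (- (\<alpha> - real k / (?d + 1)))"
      by (simp only: mult.assoc powr_add[symmetric]) simp
    also have "\<dots> = c / real N powr (\<alpha> - real k / (?d + 1))"
      by (simp only: powr_minus divide_inverse)
    finally show ?thesis .
  qed
  have inf: "(1 + \<delta>) * Q * ?E N \<le> (1 + \<delta>) * Q / real N powr \<alpha>" if "\<delta> > 0" "Q > 0" "N \<ge> 1" for \<delta> Q :: real and N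
  proof -
    have "(1 + \<delta>) * Q * ?E N \<le> (1 + \<delta>) * Q * real N powr (- \<alpha>)"
      using that assms(1) by (intro mult_left_mono exp_root_log_le) auto
    then show ?thesis
      by (simp add: powr_minus divide_inverse)
  qed
  \<comment> \<open>The bound of order 0 in \<open>QR_analytic\<close> is what links an admissible
    \<open>Q\<close> to the size of \<open>f\<close>.\<close>
  have Q_ge: "Linf_norm unit_cube f \<le> ereal Q" if "QR_analytic Q R \<Omega> f" for Q R
  proof -
    have "sobolev_seminorm 0 unit_cube f \<le> ereal (Q * (1 / R) ^ 0 * fact 0)"
      using that unfolding QR_analytic_def by blast
    then show ?thesis
      by (simp add: sobolev_seminorm_0)
  qed
  \<comment> \<open>\<open>\<mu>\<close> becomes the constant \<open>c\<close>. For
    \<open>k = 0\<close> it must not exceed any admissible \<open>Q\<close>, so it is kept below the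
    norm of \<open>f\<close>; the second case is the one without such a positive number. For
    \<open>k > 0\<close> the value 1 is chosen.\<close>
  consider "\<not> real_analytic_on f \<Omega>" | "k = 0" "Linf_norm unit_cube f \<le> 0"
    | \<mu> where "real_analytic_on f \<Omega>" "\<mu> > 0" "k = 0 \<Longrightarrow> ereal \<mu> \<le> Linf_norm unit_cube f"
  proof (cases "real_analytic_on f \<Omega>")
    case True
    show thesis
    proof (cases "k = 0 \<and> \<not> Linf_norm unit_cube f \<le> 0")
      case True
      \<comment> \<open>The norm is an extended real and might be infinite, so a real number is
        picked between 0 and it.\<close>
      then obtain \<mu> where "ereal 0 < ereal \<mu>" "ereal \<mu> < Linf_norm unit_cube f"
        using ereal_dense2[of 0 "Linf_norm unit_cube f"] by (auto simp: zero_ereal_def not_le)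
      with \<open>real_analytic_on f \<Omega>\<close> show thesis
        by (intro that(3)[of \<mu>]) auto
    next
      case False
      with \<open>real_analytic_on f \<Omega>\<close> show thesis
        using that(2) that(3)[of 1] by auto
    qed
  qed (use that in blast)
  then show ?thesis
  proof cases
    \<comment> \<open>The premise \<open>QR_analytic Q R \<Omega> f\<close> fails here, so any
      constants serve.\<close>
    case 1
    then show ?thesis
      by (intro exI[of _ 1] exI[of _ "\<lambda>_. 0"] conjI) (auto simp: QR_analytic_def)
  next
    case 2
    obtain F where F: "tanh_network [CARD('d), CARD('d), 1, 1] F" "\<And>x :: real^'d. realize F x = 0"
      using zero_network by blast
    \<comment> \<open>As \<open>f\<close> has norm at most 0, the zero network meets every
      nonnegative error bound.\<close>
    have le: "Linf_norm unit_cube (\<lambda>x. f x - realize F x) \<le> ereal e" if "e \<ge> 0" for e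
      using 2(2) that by (simp add: F(2)) (metis ereal_less_eq(5) order_trans)
    show ?thesis
    proof (rule exI[of _ 1], intro conjI, simp, rule exI[of _ "\<lambda>_. CARD('d)"], intro conjI allI impI)
      show "(\<lambda>N. real CARD('d)) \<in> O(\<lambda>N. real N)"
        by real_asymp
      fix \<delta> Q R :: real and N :: nat
      assume *: "\<delta> > 0" "Q > 0" "N \<ge> 1"
      show "\<exists>l\<^sub>1 l\<^sub>2 F.
        tanh_network [CARD('d), l\<^sub>1, l\<^sub>2, 1] F \<and> l\<^sub>1 \<le> CARD('d) \<and> l\<^sub>2 \<le> CARD('d) \<and>
        sobolev_norm k unit_cube (\<lambda>x. f x - realize F x) \<le> ereal (1 * real N powr (real k / (?d + 1)) * ?E N) \<and>
        1 * real N powr (real k / (?d + 1)) * ?E N \<le> 1 / real N powr (\<alpha> - real k / (?d + 1)) \<and>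
        (k = 0 \<longrightarrow>
          Linf_norm unit_cube (\<lambda>x. f x - realize F x) \<le> ereal ((1 + \<delta>) * Q * ?E N) \<and>
          (1 + \<delta>) * Q * ?E N \<le> (1 + \<delta>) * Q / real N powr \<alpha>)"
      proof (rule exI[of _ "CARD('d)"], rule exI[of _ 1], rule exI[of _ F], intro conjI impI)
        show "sobolev_norm k unit_cube (\<lambda>x. f x - realize F x) \<le> ereal (1 * real N powr (real k / (?d + 1)) * ?E N)"
          unfolding \<open>k = 0\<close> sobolev_norm_0 by (rule le) simp
        show "Linf_norm unit_cube (\<lambda>x. f x - realize F x) \<le> ereal ((1 + \<delta>) * Q * ?E N)"
          using * by (intro le) auto
      qed (use F(1) sob[of 1 N] inf * in auto)
    qed
  next
    case (3 \<mu>)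
    obtain A C \<rho> where \<rho>: "0 < \<rho>" "\<rho> < 1" and
      net: "\<forall>s. \<exists>F. tanh_network [CARD('d), CARD('d), (A * (s + 1) + 1) ^ CARD('d), 1] F \<and>
         sobolev_norm k unit_cube (\<lambda>x. f x - realize F x) \<le> ereal (C * \<rho> ^ s)"
      using network_rate[OF 3(1) assms(2,3), of k] by (elim exE conjE)
    obtain w where w: "(\<lambda>N. real (w N)) \<in> O(\<lambda>N. real N)"
      "\<forall>N. CARD('d) \<le> w N \<and> (\<exists>s. C * \<rho> ^ s \<le> \<mu> * ?E N \<and> (A * (s + 1) + 1) ^ CARD('d) \<le> w N)"
      using linear_width[OF \<rho> 3(2) zero_less_card_finite[where 'a = 'd], of C \<alpha> A] by (elim exE conjE)
    show ?thesis
    proof (intro exI[of _ \<mu>] exI[of _ w] conjI allI impI)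
      show "\<mu> > 0" "(\<lambda>N. real (w N)) \<in> O(\<lambda>N. real N)"
        by fact+
      fix \<delta> Q R :: real and N :: nat
      assume *: "\<delta> > 0" "Q > 0" "QR_analytic Q R \<Omega> f" "N \<ge> 1"
      obtain s where s: "C * \<rho> ^ s \<le> \<mu> * ?E N" "(A * (s + 1) + 1) ^ CARD('d) \<le> w N"
        using w(2) by blast
      obtain F where F: "tanh_network [CARD('d), CARD('d), (A * (s + 1) + 1) ^ CARD('d), 1] F"
        "sobolev_norm k unit_cube (\<lambda>x. f x - realize F x) \<le> ereal (C * \<rho> ^ s)"
        using net by blast
      have F2: "sobolev_norm k unit_cube (\<lambda>x. f x - realize F x) \<le> ereal (\<mu> * ?E N)"
        using F(2) s(1) order_trans by fastforce
      show "\<exists>l\<^sub>1 l\<^sub>2 F.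
        tanh_network [CARD('d), l\<^sub>1, l\<^sub>2, 1] F \<and> l\<^sub>1 \<le> w N \<and> l\<^sub>2 \<le> w N \<and>
        sobolev_norm k unit_cube (\<lambda>x. f x - realize F x) \<le> ereal (\<mu> * real N powr (real k / (?d + 1)) * ?E N) \<and>
        \<mu> * real N powr (real k / (?d + 1)) * ?E N \<le> \<mu> / real N powr (\<alpha> - real k / (?d + 1)) \<and>
        (k = 0 \<longrightarrow>
          Linf_norm unit_cube (\<lambda>x. f x - realize F x) \<le> ereal ((1 + \<delta>) * Q * ?E N) \<and>
          (1 + \<delta>) * Q * ?E N \<le> (1 + \<delta>) * Q / real N powr \<alpha>)"
      proof (rule exI[of _ "CARD('d)"], rule exI[of _ "(A * (s + 1) + 1) ^ CARD('d)"], rule exI[of _ F], intro conjI impI)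
        \<comment> \<open>The network already meets the bound without this factor.\<close>
        have "1 \<le> real N powr (real k / (?d + 1))"
          using *(4) by (intro ge_one_powr_ge_zero) auto
        then have "\<mu> * 1 * ?E N \<le> \<mu> * real N powr (real k / (?d + 1)) * ?E N"
          using 3(2) by (intro mult_right_mono mult_left_mono) auto
        then show "sobolev_norm k unit_cube (\<lambda>x. f x - realize F x) \<le> ereal (\<mu> * real N powr (real k / (?d + 1)) * ?E N)"
          using F2 order_trans by fastforce
        assume k: "k = 0"
        \<comment> \<open>\<open>\<mu>\<close> is at most the norm of \<open>f\<close>, and that is
          at most \<open>Q\<close>.\<close>
        have "\<mu> \<le> Q"
          using order_trans[OF 3(3)[OF k] Q_ge[OF *(3)]] by simp
        also have "Q \<le> (1 + \<delta>) * Q"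
          using * by simp
        finally have "\<mu> * ?E N \<le> (1 + \<delta>) * Q * ?E N"
          by (intro mult_right_mono) auto
        then show "Linf_norm unit_cube (\<lambda>x. f x - realize F x) \<le> ereal ((1 + \<delta>) * Q * ?E N)"
          using F2 order_trans unfolding k sobolev_norm_0 by fastforce
        show "(1 + \<delta>) * Q * ?E N \<le> (1 + \<delta>) * Q / real N powr \<alpha>"
          using * by (intro inf)
      qed (use F(1) s(2) w(2) sob[OF 3(2) *(4)] in auto)
    qed
  qed
qed

end
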